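(* Let $n\ge 4$ and let $G$ be the game board consisting of a cycle $C_3$ and a cycle $C_n$ connected by a single common vertex $a$, such that every edge of $G$ belongs to exactly one of the two cycles (drawn in the plane so that the two cycles bound two distinct cells). Then Player~1 has a winning strategy in the Game of Cycles on $G$.
   Context: The Game of Cycles: the board is a simple planar graph with a fixed planar embedding; its cells are the bounded faces of the embedding. Two players alternate turns; on a turn a player chooses a currently unmarked edge and marks it with an arrow (an orientation), subject to the sink-source rule: no move may create a sink (a vertex all of whose incident edges are marked and point toward it) or a source (a vertex all of whose incident edges are marked and point away from it). A cycle cell is a cell all of whose boundary edges are marked and oriented consistently, all clockwise or all counterclockwise around the cell. The first player to create a cycle cell wins; if no cycle cell is created, the player who makes the last possible legal move wins (a player with no legal move loses). A winning strategy for a player is a strategy guaranteeing that player a win regardless of the opponent's moves. *)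

theory Defs
  imports "HOL-Complex_Analysis.Complex_Analysis"
begin

section \<open>Boards: simple graphs with a fixed drawing in the plane\<close>

text \<open>
  The drawing assigns a point to every vertex and a curve to every edge;
  \<open>curve G u v\<close> is the curve of the edge \<open>{u, v}\<close>, traversed from \<open>u\<close> to \<open>v\<close>.
\<close>

record 'v board =
  verts :: "'v set"
  edges :: "'v set set"
  pos :: "'v \<Rightarrow> complex"
  curve :: "'v \<Rightarrow> 'v \<Rightarrow> real \<Rightarrow> complex"

definition simple_graph :: "'v set \<Rightarrow> 'v set set \<Rightarrow> bool" where
  "simple_graph V E \<longleftrightarrow>
     finite V \<and> (\<forall>e\<in>E. \<exists>u v. u \<in> V \<and> v \<in> V \<and> u \<noteq> v \<and> e = {u, v})"

definition plane_board :: "'v board \<Rightarrow> bool" where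
  "plane_board G \<longleftrightarrow>
     simple_graph (verts G) (edges G) \<and>
     inj_on (pos G) (verts G) \<and>
     (\<forall>u v. {u, v} \<in> edges G \<longrightarrow>
        arc (curve G u v) \<and>
        pathstart (curve G u v) = pos G u \<and> pathfinish (curve G u v) = pos G v \<and>
        curve G v u = reversepath (curve G u v) \<and>
        path_image (curve G u v) \<inter> pos G ` verts G = {pos G u, pos G v}) \<and>
     (\<forall>u v x y. {u, v} \<in> edges G \<and> {x, y} \<in> edges G \<and> {u, v} \<noteq> {x, y} \<longrightarrow>
        path_image (curve G u v) \<inter> path_image (curve G x y) \<subseteq> pos G ` ({u, v} \<inter> {x, y}))"

definition edges_drawing :: "'v board \<Rightarrow> 'v set set \<Rightarrow> complex set" where
  "edges_drawing G D = (\<Union>{path_image (curve G u v) | u v. {u, v} \<in> D})"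

definition drawing :: "'v board \<Rightarrow> complex set" where
  "drawing G = pos G ` verts G \<union> edges_drawing G (edges G)"

definition cells :: "'v board \<Rightarrow> complex set set" where
  "cells G = {F \<in> components (- drawing G). bounded F}"

definition boundary_edges :: "'v board \<Rightarrow> complex set \<Rightarrow> 'v set set" where
  "boundary_edges G F = {e \<in> edges G. edges_drawing G {e} \<subseteq> frontier F}"

section \<open>Markings\<close>

text \<open>
  A marking is a set of ordered pairs; \<open>(u, v)\<close> is an arrow from \<open>u\<close> to \<open>v\<close> on the edge \<open>{u, v}\<close>.
\<close>

definition marked :: "('v \<times> 'v) set \<Rightarrow> 'v set \<Rightarrow> bool" where
  "marked M e \<longleftrightarrow> (\<exists>u v. e = {u, v} \<and> (u, v) \<in> M)"

definition sink :: "'v board \<Rightarrow> ('v \<times> 'v) set \<Rightarrow> 'v \<Rightarrow> bool" where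
  "sink G M v \<longleftrightarrow> v \<in> verts G \<and> (\<forall>u. {u, v} \<in> edges G \<longrightarrow> (u, v) \<in> M)"

definition source :: "'v board \<Rightarrow> ('v \<times> 'v) set \<Rightarrow> 'v \<Rightarrow> bool" where
  "source G M v \<longleftrightarrow> v \<in> verts G \<and> (\<forall>u. {u, v} \<in> edges G \<longrightarrow> (v, u) \<in> M)"

text \<open>
  Arrows are counterclockwise around a cell \<open>F\<close> if \<open>F\<close> lies to the left of each of them, i.e. if
  together they form the positively oriented boundary of \<open>F\<close>: the arrows on the boundary edges wind
  once around the points of \<open>F\<close> and do not wind around the points beyond the boundary. The
  second condition matters for cells that are not simply connected or have cut vertices on
  their boundary: there the outer and the inner boundary cycles must run in opposite senses.
\<close>

definition boundary_winding ::
    "'v board \<Rightarrow> ('v \<times> 'v) set \<Rightarrow> complex set \<Rightarrow> complex \<Rightarrow> complex" where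
  "boundary_winding G M F z =
     (\<Sum>(u, v) \<in> {(u, v). (u, v) \<in> M \<and> {u, v} \<in> boundary_edges G F}. winding_number (curve G u v) z)"

definition counterclockwise_around ::
    "'v board \<Rightarrow> ('v \<times> 'v) set \<Rightarrow> complex set \<Rightarrow> bool" where
  "counterclockwise_around G M F \<longleftrightarrow>
     (\<forall>z\<in>F. boundary_winding G M F z = 1) \<and> (\<forall>z. z \<notin> closure F \<longrightarrow> boundary_winding G M F z = 0)"

definition clockwise_around ::
    "'v board \<Rightarrow> ('v \<times> 'v) set \<Rightarrow> complex set \<Rightarrow> bool" where
  "clockwise_around G M F \<longleftrightarrow>
     (\<forall>z\<in>F. boundary_winding G M F z = -1) \<and> (\<forall>z. z \<notin> closure F \<longrightarrow> boundary_winding G M F z = 0)"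

definition cycle_cell :: "'v board \<Rightarrow> ('v \<times> 'v) set \<Rightarrow> complex set \<Rightarrow> bool" where
  "cycle_cell G M F \<longleftrightarrow>
     F \<in> cells G \<and> (\<forall>e\<in>boundary_edges G F. marked M e) \<and>
     (clockwise_around G M F \<or> counterclockwise_around G M F)"

section \<open>The Game of Cycles\<close>

definition legal_move :: "'v board \<Rightarrow> ('v \<times> 'v) set \<Rightarrow> 'v \<times> 'v \<Rightarrow> bool" where
  "legal_move G M m \<longleftrightarrow>
     {fst m, snd m} \<in> edges G \<and> \<not> marked M {fst m, snd m} \<and>
     (\<forall>w. sink G (insert m M) w \<longrightarrow> sink G M w) \<and>
     (\<forall>w. source G (insert m M) w \<longrightarrow> source G M w)"

text \<open>A play is recorded as the chronological list of moves; it stops at the first cycle cell.\<close>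

inductive play :: "'v board \<Rightarrow> ('v \<times> 'v) list \<Rightarrow> bool" for G where
  start: "play G []"
| move: "play G ms \<Longrightarrow> \<not> (\<exists>F. cycle_cell G (set ms) F) \<Longrightarrow> legal_move G (set ms) m
           \<Longrightarrow> play G (ms @ [m])"

definition finished :: "'v board \<Rightarrow> ('v \<times> 'v) list \<Rightarrow> bool" where
  "finished G ms \<longleftrightarrow> (\<exists>F. cycle_cell G (set ms) F) \<or> \<not> (\<exists>m. legal_move G (set ms) m)"

datatype player = Player1 | Player2

definition to_move :: "('v \<times> 'v) list \<Rightarrow> player" where
  "to_move ms = (if even (length ms) then Player1 else Player2)"

text \<open>
  In a finished play either the player who just moved created a cycle cell, or the player whose
  turn it is has no legal move; in both cases the player whose turn it is has lost.
\<close>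

definition winner :: "('v \<times> 'v) list \<Rightarrow> player" where
  "winner ms = (case to_move ms of Player1 \<Rightarrow> Player2 | Player2 \<Rightarrow> Player1)"

definition follows :: "player \<Rightarrow> (('v \<times> 'v) list \<Rightarrow> 'v \<times> 'v) \<Rightarrow> ('v \<times> 'v) list \<Rightarrow> bool" where
  "follows P \<sigma> ms \<longleftrightarrow>
     (\<forall>k < length ms. to_move (take k ms) = P \<longrightarrow> ms ! k = \<sigma> (take k ms))"

text \<open>
  Every play is finite, since each move marks a new edge. So it suffices that the strategy always
  supplies a legal move when needed and that every finished play following it is won.
\<close>

definition winning_strategy ::
    "'v board \<Rightarrow> player \<Rightarrow> (('v \<times> 'v) list \<Rightarrow> 'v \<times> 'v) \<Rightarrow> bool" where
  "winning_strategy G P \<sigma> \<longleftrightarrow>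
     (\<forall>ms. play G ms \<and> follows P \<sigma> ms \<longrightarrow>
        (if finished G ms then winner ms = P
         else to_move ms = P \<longrightarrow> legal_move G (set ms) (\<sigma> ms)))"

section \<open>Cycle graphs\<close>

definition cycle_graph :: "nat \<Rightarrow> 'v set \<Rightarrow> 'v set set \<Rightarrow> bool" where
  "cycle_graph k V E \<longleftrightarrow>
     k \<ge> 3 \<and> (\<exists>vs. length vs = k \<and> distinct vs \<and> V = set vs \<and>
                  E = {{vs ! i, vs ! (Suc i mod k)} | i. i < k})"

end

theory Submission
  imports Defs
begin

text \<open>
  Cut both cycles open at \<open>a\<close>. At a vertex of degree two, having no sink and no source means that its
  two arrows, once marked, point the same way along the cycle; so a cycle whose edges are all marked
  is automatically a cycle cell, and the game is played on two words over \<open>{+, -, blank}\<close> of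
  lengths 3 and \<open>n\<close> in which neighbouring signs agree. The vertex \<open>a\<close> only forbids that the four end
  letters all point into \<open>a\<close> or all out of it. Whoever fills a word wins.

  If \<open>n\<close> is even, Player 1 marks the middle edge of the triangle. Either player to mark another
  triangle edge then loses at once, and Player 1 answers on the long word by mirroring with the same
  sign, which never lets Player 2 fill it. If \<open>n = 2m + 1\<close>, Player 1 marks the first triangle edge.
  The only move in the triangle that does not lose at once is now to mark the last edge with the
  opposite sign, which blocks the triangle for good. Player 1 pairs this move with the middle letter
  of the long word and otherwise mirrors. The exception is when mirroring would leave only the middle
  letter blank: then Player 1 blocks the triangle, and Player 2 has to leave the last blank to Player 1.

  Geometrically, the two given cells are the insides of the two Jordan curves, and Janiszewski's
  theorem shows that there is no third cell.
\<close>

section \<open>The game on two words\<close>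

definition chain :: "nat \<Rightarrow> (nat \<Rightarrow> bool option) \<Rightarrow> bool" where
  "chain k x \<longleftrightarrow> (\<forall>i s t. Suc i < k \<longrightarrow> x i = Some s \<longrightarrow> x (Suc i) = Some t \<longrightarrow> s = t)"

definition full :: "nat \<Rightarrow> (nat \<Rightarrow> bool option) \<Rightarrow> bool" where
  "full k x \<longleftrightarrow> (\<forall>i<k. x i \<noteq> None)"

definition palindromic :: "nat \<Rightarrow> (nat \<Rightarrow> bool option) \<Rightarrow> bool" where
  "palindromic k x \<longleftrightarrow> (\<forall>i<k. x (k - 1 - i) = x i)"

text \<open>
  Letter \<open>i\<close> of a word is the direction of the \<open>i\<close>-th edge met when walking around the cycle from
  \<open>a\<close>, so \<open>True\<close> points out of \<open>a\<close> on the first edge but into \<open>a\<close> on the last one.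
\<close>

definition admissible :: "nat \<Rightarrow> (nat \<Rightarrow> bool option) \<Rightarrow> (nat \<Rightarrow> bool option) \<Rightarrow> bool" where
  "admissible n x y \<longleftrightarrow> chain 3 x \<and> chain n y \<and>
     (\<forall>s. \<not> (x 0 = Some s \<and> x 2 = Some (\<not> s) \<and> y 0 = Some s \<and> y (n - 1) = Some (\<not> s)))"

type_synonym position = "(nat \<Rightarrow> bool option) \<times> (nat \<Rightarrow> bool option)"

text \<open>The relation ignores whether a word is already filled; stopping there is left to
  \<open>safe\<close>, which looks only at play from positions that are not won.\<close>

inductive step :: "nat \<Rightarrow> position \<Rightarrow> position \<Rightarrow> bool" for n where
  left: "i < 3 \<Longrightarrow> x i = None \<Longrightarrow> admissible n (x(i \<mapsto> s)) y \<Longrightarrow> step n (x, y) (x(i \<mapsto> s), y)"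
| right: "j < n \<Longrightarrow> y j = None \<Longrightarrow> admissible n x (y(j \<mapsto> s)) \<Longrightarrow> step n (x, y) (x, y(j \<mapsto> s))"

fun won :: "nat \<Rightarrow> position \<Rightarrow> bool" where
  "won n (x, y) \<longleftrightarrow> full 3 x \<or> full n y"

text \<open>\<open>I\<close> describes positions with Player 2 to move. No move of Player 2 wins at
  once, and Player 1 always has a reply that wins or restores \<open>I\<close>, so Player 1 never
  runs out of moves.\<close>

definition safe :: "nat \<Rightarrow> (position \<Rightarrow> bool) \<Rightarrow> bool" where
  "safe n I \<longleftrightarrow> (\<forall>p q. I p \<longrightarrow> \<not> won n p \<longrightarrow> step n p q \<longrightarrow>
     \<not> won n q \<and> (\<exists>r. step n q r \<and> (won n r \<or> I r)))"

section \<open>Neighbouring letters and mirror images\<close>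

lemma chain3: "chain 3 x \<longleftrightarrow>
    (\<forall>s t. x 0 = Some s \<longrightarrow> x 1 = Some t \<longrightarrow> s = t) \<and> (\<forall>s t. x 1 = Some s \<longrightarrow> x 2 = Some t \<longrightarrow> s = t)"
  by (auto simp: chain_def numeral_3_eq_3 numeral_2_eq_2 less_Suc_eq)

lemma full3: "full 3 x \<longleftrightarrow> x 0 \<noteq> None \<and> x 1 \<noteq> None \<and> x 2 \<noteq> None"
  by (auto simp: full_def numeral_3_eq_3 numeral_2_eq_2 less_Suc_eq)

lemma less3: "(i::nat) < 3 \<longleftrightarrow> i = 0 \<or> i = 1 \<or> i = 2"
  by auto

lemma chainD: "chain k x \<Longrightarrow> Suc i < k \<Longrightarrow> x i = Some s \<Longrightarrow> x (Suc i) = Some t \<Longrightarrow> s = t"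
  by (auto simp: chain_def)

lemma chain_const:
  assumes "\<And>i t. i < k \<Longrightarrow> x i = Some t \<Longrightarrow> t = s"
  shows "chain k x"
  using assms unfolding chain_def by (metis Suc_lessD)

lemma palindromic_ends: "palindromic n y \<Longrightarrow> 0 < n \<Longrightarrow> y (n - 1) = y 0"
  by (auto simp: palindromic_def)

lemma palindromic_upd:
  assumes "palindromic n y" "j < n"
  shows "palindromic n (y(j \<mapsto> s, n - 1 - j \<mapsto> s))"
  unfolding palindromic_def
proof (intro allI impI)
  fix i assume i: "i < n"
  consider "i = j" | "i = n - 1 - j" | "i \<noteq> j" "i \<noteq> n - 1 - j" "n - 1 - i \<noteq> j" "n - 1 - i \<noteq> n - 1 - j"
    using i assms(2) by fastforce
  then show "(y(j \<mapsto> s, n - 1 - j \<mapsto> s)) (n - 1 - i) = (y(j \<mapsto> s, n - 1 - j \<mapsto> s)) i"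
  proof cases
    case 3
    then show ?thesis using assms i by (simp add: palindromic_def)
  qed (use assms in auto)
qed

text \<open>The only pairs of neighbours that the second update can spoil contain position
  \<open>n - 1 - j\<close>. Reflection carries such a pair to one containing \<open>j\<close>, whose
  letters agree by the hypothesis on \<open>y(j \<mapsto> s)\<close>. If \<open>j\<close> and its
  mirror image are adjacent, both hold \<open>s\<close>.\<close>

lemma chain_mirror:
  assumes pal: "palindromic n y" and j: "j < n" and ch: "chain n (y(j \<mapsto> s))"
  shows "chain n (y(j \<mapsto> s, n - 1 - j \<mapsto> s))"
  unfolding chain_def
proof (intro allI impI)
  fix k t u
  let ?z = "y(j \<mapsto> s)" let ?y = "y(j \<mapsto> s, n - 1 - j \<mapsto> s)"
  assume k: "Suc k < n" and t: "?y k = Some t" and u: "?y (Suc k) = Some u"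
  have palD: "y (n - 1 - i) = y i" if "i < n" for i
    using pal that by (simp add: palindromic_def)
  show "t = u"
  proof (cases "k = n - 1 - j \<or> Suc k = n - 1 - j")
    case False
    then show ?thesis
      using chainD[OF ch k] t u by auto
  next
    case True
    then show ?thesis
    proof
      assume e: "k = n - 1 - j"
      then have ts: "t = s" using t by simp
      have j1: "Suc (j - 1) = j" and nk: "n - 1 - Suc k = j - 1" and jl: "Suc (j - 1) < n"
        using e k j by auto
      show ?thesis
      proof (cases "Suc k = j")
        case True then show ?thesis using u ts e by (auto split: if_splits)
      next
        case False
        then have "y (Suc k) = Some u" using u e by auto
        then have "y (j - 1) = Some u" using palD[OF k] nk by simp
        then have "?z (j - 1) = Some u" using j1 by auto
        moreover have "?z (Suc (j - 1)) = Some s" using j1 by simp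
        ultimately show ?thesis using chainD[OF ch jl] ts by blast
      qed
    next
      assume e: "Suc k = n - 1 - j"
      then have us: "u = s" using u by simp
      have nk: "n - 1 - k = Suc j" and jl: "Suc j < n" and kn: "k < n"
        using e k j by auto
      show ?thesis
      proof (cases "k = j")
        case True then show ?thesis using t us e by (auto split: if_splits)
      next
        case False
        then have "y k = Some t" using t e by auto
        then have "y (Suc j) = Some t" using palD[OF kn] nk by simp
        then have "?z (Suc j) = Some t" by auto
        moreover have "?z j = Some s" by simp
        ultimately show ?thesis using chainD[OF ch jl] us by blast
      qed
    qed
  qed
qed

text \<open>Agreement of neighbours spreads the first letter over the left half, and the symmetry
  copies it to the right half. It cannot be carried across the middle, which may be blank.\<close>

lemma palindromic_full_const:
  assumes n: "n = 2 * m + 1" and pal: "palindromic n y" and ch: "chain n y"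
    and f: "\<forall>k<n. k \<noteq> m \<longrightarrow> y k \<noteq> None" and "0 < m"
  shows "\<exists>s. \<forall>k<n. k \<noteq> m \<longrightarrow> y k = Some s"
proof -
  obtain s where s: "y 0 = Some s" using f n \<open>0 < m\<close> by auto
  have lo: "k < m \<Longrightarrow> y k = Some s" for k
  proof (induction k)
    case (Suc k)
    obtain t where "y (Suc k) = Some t" using f[rule_format, of "Suc k"] Suc.prems n by auto
    then show ?case using Suc chainD[OF ch, of k s t] n by auto
  qed (use s in simp)
  have "y k = Some s" if "k < n" "k \<noteq> m" for k
  proof (cases "k < m")
    case False
    then have "n - 1 - k < m" using that n by auto
    then show ?thesis using lo pal that unfolding palindromic_def by metis
  qed (use lo in simp)
  then show ?thesis by blast
qed

text \<open>In the triangle, a neighbour of the middle letter must repeat \<open>True\<close>, after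
  which Player 1 adds the third letter. A letter of the long word is mirrored; while both end
  letters of the triangle are blank, the common vertex imposes no restriction.\<close>

lemma win_even:
  assumes n: "even n" "n \<ge> 4"
  shows "safe n (\<lambda>(x, y). x = [1 \<mapsto> True] \<and> palindromic n y \<and> chain n y)"
  unfolding safe_def
proof (intro allI impI)
  fix p q
  let ?I = "\<lambda>(x, y). x = [1 \<mapsto> True] \<and> palindromic n y \<and> chain n y"
  assume I: "?I p" and nw: "\<not> won n p" and st: "step n p q"
  obtain y where p: "p = ([1 \<mapsto> True], y)" and pal: "palindromic n y" and ch: "chain n y"
    using I by (cases p) auto
  have nf: "\<not> full n y" using nw p by simp
  from st[unfolded p] show "\<not> won n q \<and> (\<exists>r. step n q r \<and> (won n r \<or> ?I r))"
  proof cases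
    case (left i s)
    have i: "(i = 0 \<or> i = 2) \<and> s = True"
      using left by (auto simp: admissible_def chain3 less3 split: if_splits)
    let ?x = "[1 \<mapsto> True, i \<mapsto> True]"
    have "step n (?x, y) (?x(2 - i \<mapsto> True), y)"
      by (rule step.left) (use i ch in \<open>auto simp: admissible_def chain3\<close>)
    moreover have "full 3 (?x(2 - i \<mapsto> True))"
      using i by (auto simp: full3)
    moreover have "\<not> full 3 ?x" using i by (auto simp: full3)
    ultimately show ?thesis using left i nf by auto
  next
    case (right j s)
    let ?j = "n - 1 - j"
    \<comment> \<open>\<open>j\<close> and its mirror image add up to the odd number
      \<open>n - 1\<close>, so they differ.\<close>
    have jj: "?j \<noteq> j" using n right by presburger
    have yj: "y ?j = None" using right pal by (auto simp: palindromic_def)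
    have "\<not> full n (y(j \<mapsto> s))"
      using jj yj right unfolding full_def by (intro notI) (auto dest: spec[of _ ?j])
    moreover have "step n ([1 \<mapsto> True], y(j \<mapsto> s)) ([1 \<mapsto> True], y(j \<mapsto> s, ?j \<mapsto> s))"
      by (rule step.right)
        (use right jj yj chain_mirror[OF pal, of j s] in \<open>auto simp: admissible_def chain3\<close>)
    moreover have "?I ([1 \<mapsto> True], y(j \<mapsto> s, ?j \<mapsto> s))"
      using palindromic_upd[OF pal, of j s] chain_mirror[OF pal, of j s] right by (simp add: admissible_def)
    ultimately show ?thesis using right by (auto simp: full3)
  qed
qed


text \<open>
  The three cases: the triangle is still open; it is blocked and Player 1 mirrors; it was blocked
  when mirroring would have left only the middle letter blank.
\<close>

definition odd_invariant :: "nat \<Rightarrow> position \<Rightarrow> bool" where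
  "odd_invariant m = (\<lambda>(x, y). let n = 2 * m + 1 in
     x = [0 \<mapsto> True] \<and> palindromic n y \<and> chain n y \<and> y m = None \<and> (\<exists>k<n. k \<noteq> m \<and> y k = None) \<or>
     x = [0 \<mapsto> True, 2 \<mapsto> False] \<and> palindromic n y \<and> chain n y \<and> y m \<noteq> None \<or>
     x = [0 \<mapsto> True, 2 \<mapsto> False] \<and>
       (\<exists>s j. j < n \<and> j \<noteq> m \<and> (\<forall>k<n. y k = (if k = m \<or> k = j then None else Some s))))"

text \<open>The middle triangle edge lies between opposite signs and can never be marked. Player 2
  must therefore fill one of the two gaps, with the sign \<open>s\<close> of a marked neighbour, and
  Player 1 fills the other.\<close>

lemma two_gaps_reply:
  assumes n: "n = 2 * m + 1" and m: "2 \<le> m" and j: "j < n" "j \<noteq> m"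
    and y: "\<And>k. k < n \<Longrightarrow> y k = (if k = m \<or> k = j then None else Some s)"
    and st: "step n ([0 \<mapsto> True, 2 \<mapsto> False], y) q"
  shows "\<not> won n q \<and> (\<exists>r. step n q r \<and> won n r)"
  using st
proof cases
  case (left i t)
  then show ?thesis
    by (auto simp: admissible_def chain3 less3 split: if_splits)
next
  case (right i t)
  then have i: "i = m \<or> i = j" using y by (metis option.distinct(1))
  let ?x = "[0 \<mapsto> True, 2 \<mapsto> False]"
  define l where "l = (if i = m then j else m)"
  have l: "l < n" "l \<noteq> i" "{i, l} = {m, j}"
    using i j n by (auto simp: l_def)
  have yy: "y k = (if k \<in> {i, l} then None else Some s)" if "k < n" for k
    using y[OF that] l(3) by auto
  have ch: "chain n (y(i \<mapsto> t))" using right by (simp add: admissible_def)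
  have ts: "t = s"
  proof -
    \<comment> \<open>Some neighbour of the gap \<open>i\<close> is marked. An inner position has
      two neighbours, and at most one of them is the other gap \<open>l\<close>; an end position is
      the gap \<open>j\<close>, and its neighbour is not \<open>m\<close> since
      \<open>2 \<le> m\<close>.\<close>
    have "0 < i \<and> i - 1 \<noteq> l \<or> Suc i < n \<and> Suc i \<noteq> l"
      using i j m n by (auto simp: l_def)
    then show ?thesis
    proof
      assume a: "0 < i \<and> i - 1 \<noteq> l"
      then have "(y(i \<mapsto> t)) (i - 1) = Some s" using yy[of "i - 1"] right(2) by auto
      then show ?thesis using chainD[OF ch, of "i - 1" s t] a right(2) by auto
    next
      assume a: "Suc i < n \<and> Suc i \<noteq> l"
      then have "(y(i \<mapsto> t)) (Suc i) = Some s" using yy[of "Suc i"] by auto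
      then show ?thesis using chainD[OF ch, of i t s] a by auto
    qed
  qed
  let ?y = "y(i \<mapsto> s, l \<mapsto> s)"
  have fy: "?y k = Some s" if "k < n" for k using yy[OF that] by auto
  have "chain n ?y" by (rule chain_const[where s = s]) (use fy in auto)
  then have "step n (?x, y(i \<mapsto> s)) (?x, ?y)"
    by (intro step.right) (use l yy fy[of 0] fy[of "n - 1"] n in \<open>auto simp: admissible_def chain3\<close>)
  moreover have "full n ?y" using fy by (auto simp: full_def)
  moreover have "\<not> full n (y(i \<mapsto> s))"
  proof
    assume "full n (y(i \<mapsto> s))"
    then have "y l \<noteq> None" using l(1,2) unfolding full_def by (metis fun_upd_other)
    then show False using yy[OF l(1)] by simp
  qed
  ultimately show ?thesis using right ts by (auto simp: full3)
qed

text \<open>The triangle admits no further move, and the middle letter of the long word is already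
  marked, so the mirror image of any move of Player 2 is a different, blank position.\<close>

lemma blocked_reply:
  assumes n: "n = 2 * m + 1" and pal: "palindromic n y" and ym: "y m \<noteq> None"
    and st: "step n ([0 \<mapsto> True, 2 \<mapsto> False], y) q"
  shows "\<not> won n q \<and> (\<exists>r. step n q r \<and> odd_invariant m r)"
  using st
proof cases
  case (left i t)
  then show ?thesis
    by (auto simp: admissible_def chain3 less3 split: if_splits)
next
  case (right j s)
  let ?j = "n - 1 - j" and ?x = "[0 \<mapsto> True, 2 \<mapsto> False]"
  let ?y = "y(j \<mapsto> s, ?j \<mapsto> s)"
  have jm: "j \<noteq> m" using right ym by auto
  then have jj: "?j \<noteq> j" "?j < n" "?j \<noteq> m" using n right(2) by auto
  have yj: "y ?j = None" using right pal by (auto simp: palindromic_def)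
  have py: "palindromic n ?y" by (rule palindromic_upd[OF pal right(2)])
  have cy: "chain n ?y"
    using chain_mirror[OF pal right(2), of s] right by (simp add: admissible_def)
  have "\<not> full n (y(j \<mapsto> s))"
    using jj yj unfolding full_def by (intro notI) (auto dest: spec[of _ ?j])
  moreover have "step n (?x, y(j \<mapsto> s)) (?x, ?y)"
  proof (rule step.right)
    \<comment> \<open>Both outer triangle edges point out of the common vertex, so only a source
      could arise there. It needs different end letters in the long word, whereas a palindrome has
      equal ones.\<close>
    have "?y (n - 1) = ?y 0" using palindromic_ends[OF py] n by simp
    then show "admissible n ?x ?y" using cy by (simp add: admissible_def chain3)
  qed (use jj yj in auto)
  moreover have "odd_invariant m (?x, ?y)"
    using py cy ym jm jj n by (auto simp: odd_invariant_def Let_def)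
  ultimately show ?thesis using right by (auto simp: full3)
qed

text \<open>A \<open>True\<close> in the triangle lets Player 1 fill it. Blocking the triangle and
  taking the middle letter answer each other. Any other letter is mirrored, unless only the middle
  would stay blank; Player 1 then blocks and leaves two gaps in the long word.\<close>

lemma open_reply:
  assumes n: "n = 2 * m + 1" and m: "2 \<le> m" and pal: "palindromic n y" and ch: "chain n y"
    and ym: "y m = None" and k0: "k0 < n" "k0 \<noteq> m" "y k0 = None"
    and st: "step n ([0 \<mapsto> True], y) q"
  shows "\<not> won n q \<and> (\<exists>r. step n q r \<and> (won n r \<or> odd_invariant m r))"
proof -
  have mn: "m < n" using n by simp
  have nf: "\<not> full n y" using ym mn by (auto simp: full_def)
  have ends: "y (n - 1) = y 0" using palindromic_ends[OF pal] n by simp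
  from st show ?thesis
  proof cases
    case (left i s)
    have "(i = 1 \<or> i = 2) \<and> s = True \<or> i = 2 \<and> s = False"
      using left by (auto simp: admissible_def chain3 less3 split: if_splits)
    then show ?thesis
    proof
      assume i: "(i = 1 \<or> i = 2) \<and> s = True"
      let ?x = "[0 \<mapsto> True, i \<mapsto> True]"
      have "step n (?x, y) (?x(3 - i \<mapsto> True), y)"
        by (rule step.left) (use i ch in \<open>auto simp: admissible_def chain3\<close>)
      moreover have "full 3 (?x(3 - i \<mapsto> True))"
        using i by (auto simp: full3)
      moreover have "\<not> full 3 ?x" using i by (auto simp: full3)
      ultimately show ?thesis using left i nf by auto
    next
      assume i: "i = 2 \<and> s = False"
      let ?x = "[0 \<mapsto> True, 2 \<mapsto> False]"
      \<comment> \<open>The two neighbours of the middle letter are equal by symmetry, so copying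
        the left one agrees with both; \<open>True\<close> is an arbitrary choice for the case that
        they are blank.\<close>
      define t where "t = (case y (m - 1) of None \<Rightarrow> True | Some t \<Rightarrow> t)"
      have mm: "n - 1 - m = m" using n by simp
      have nb: "y (Suc m) = y (m - 1)"
        using pal[unfolded palindromic_def, rule_format, of "m - 1"] n m by (simp add: Suc_diff_Suc)
      have chm: "chain n (y(m \<mapsto> t))"
        unfolding chain_def
      proof (intro allI impI)
        fix k u v
        assume k: "Suc k < n" and u: "(y(m \<mapsto> t)) k = Some u" and v: "(y(m \<mapsto> t)) (Suc k) = Some v"
        consider "k = m" | "Suc k = m" | "k \<noteq> m" "Suc k \<noteq> m" by blast
        then show "u = v"
        proof cases
          case 1 then show ?thesis using u v nb by (auto simp: t_def)
        next
          case 2 then show ?thesis using u v by (auto simp: t_def)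
        next
          case 3 then show ?thesis using u v chainD[OF ch k] by auto
        qed
      qed
      have pm: "palindromic n (y(m \<mapsto> t))"
        using palindromic_upd[OF pal mn, of t] mm by simp
      have "step n (?x, y) (?x, y(m \<mapsto> t))"
      proof (rule step.right)
        have "(y(m \<mapsto> t)) (n - 1) = (y(m \<mapsto> t)) 0" using palindromic_ends[OF pm] n by simp
        then show "admissible n ?x (y(m \<mapsto> t))" using chm by (simp add: admissible_def chain3)
      qed (use mn ym in auto)
      moreover have "odd_invariant m (?x, y(m \<mapsto> t))"
        using pm chm n by (simp add: odd_invariant_def)
      ultimately show ?thesis using left i nf by (auto simp: full3)
    qed
  next
    case (right j s)
    let ?x = "[0 \<mapsto> True]" and ?x' = "[0 \<mapsto> True, 2 \<mapsto> False]" and ?j = "n - 1 - j"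
    let ?y = "y(j \<mapsto> s, ?j \<mapsto> s)"
    have chj: "chain n (y(j \<mapsto> s))" using right by (simp add: admissible_def)
    have py: "palindromic n ?y" by (rule palindromic_upd[OF pal right(2)])
    have cy: "chain n ?y" using chain_mirror[OF pal right(2) chj] .
    show ?thesis
    proof (cases "j = m")
      case True
      then have e: "?y = y(j \<mapsto> s)" using n by simp
      \<comment> \<open>The blank at \<open>k0\<close> is what prevents Player 2 from filling the
        word by taking the middle letter.\<close>
      have "\<not> full n (y(j \<mapsto> s))" using k0 True by (auto simp: full_def)
      moreover have "step n (?x, y(j \<mapsto> s)) (?x(2 \<mapsto> False), y(j \<mapsto> s))"
      proof (rule step.left)
        have "(y(j \<mapsto> s)) (n - 1) = (y(j \<mapsto> s)) 0" using palindromic_ends[OF py[unfolded e]] n by simp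
        then show "admissible n (?x(2 \<mapsto> False)) (y(j \<mapsto> s))" using chj by (simp add: admissible_def chain3)
      qed auto
      moreover have "odd_invariant m (?x', y(j \<mapsto> s))"
        using py chj n True e by (simp add: odd_invariant_def)
      ultimately show ?thesis using right by (auto simp: full3)
    next
      case False
      then have jj: "?j \<noteq> j" "?j < n" "?j \<noteq> m" using n right(2) by auto
      have yj: "y ?j = None" using right pal by (auto simp: palindromic_def)
      have nf': "\<not> full n (y(j \<mapsto> s))" using ym mn False by (auto simp: full_def)
      show ?thesis
      proof (cases "\<exists>k<n. k \<noteq> m \<and> ?y k = None")
        case True
        have "step n (?x, y(j \<mapsto> s)) (?x, ?y)"
          by (rule step.right) (use cy jj yj in \<open>auto simp: admissible_def chain3\<close>)
        moreover have "odd_invariant m (?x, ?y)"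
        proof -
          have "?y m = None" using ym jj False by auto
          then show ?thesis using py cy n True by (simp add: odd_invariant_def)
        qed
        ultimately show ?thesis using right nf' by (auto simp: full3)
      next
        case nt: False
        have f: "\<forall>k<n. k \<noteq> m \<longrightarrow> ?y k \<noteq> None"
        proof (intro allI impI notI)
          fix k assume "k < n" "k \<noteq> m" "?y k = None"
          then have "\<exists>k<n. k \<noteq> m \<and> ?y k = None" by (intro exI[of _ k] conjI)
          with nt show False by (rule notE)
        qed
        have "0 < m" using m by simp
        from palindromic_full_const[OF n py cy f this]
        obtain u where u: "\<forall>k<n. k \<noteq> m \<longrightarrow> ?y k = Some u" ..
        \<comment> \<open>Without a mirroring reply, the blanks are exactly the middle and the
          mirror image of \<open>j\<close>. Once the triangle is blocked, this is the third case of
          \<open>odd_invariant\<close>.\<close>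
        have gaps: "(y(j \<mapsto> s)) k = (if k = m \<or> k = ?j then None else Some u)" if "k < n" for k
          using u[rule_format, OF that] ym yj jj False by auto
        have "step n (?x, y(j \<mapsto> s)) (?x(2 \<mapsto> False), y(j \<mapsto> s))"
        proof (rule step.left)
          \<comment> \<open>Each end letter of the long word is blank or \<open>u\<close>, so the
            two triangle edges pointing out of the common vertex do not become part of a
            source.\<close>
          show "admissible n (?x(2 \<mapsto> False)) (y(j \<mapsto> s))"
            using chj gaps[of 0] gaps[of "n - 1"] n by (auto simp: admissible_def chain3 split: if_splits)
        qed auto
        moreover have "odd_invariant m (?x', y(j \<mapsto> s))"
          unfolding odd_invariant_def Let_def prod.case n[symmetric]
          by (intro disjI2 conjI refl exI[of _ u] exI[of _ ?j]) (use gaps jj in auto)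
        ultimately show ?thesis using right nf' by (auto simp: full3)
      qed
    qed
  qed
qed

lemma win_odd:
  assumes n: "n = 2 * m + 1" and m: "2 \<le> m"
  shows "safe n (odd_invariant m)"
  unfolding safe_def
proof (intro allI impI)
  fix p q
  assume I: "odd_invariant m p" and st: "step n p q"
  obtain x y where p: "p = (x, y)" by (cases p)
  from I[unfolded odd_invariant_def Let_def p prod.case n[symmetric]]
  show "\<not> won n q \<and> (\<exists>r. step n q r \<and> (won n r \<or> odd_invariant m r))"
  proof (elim disjE conjE exE)
    fix k0 assume "x = [0 \<mapsto> True]" "palindromic n y" "chain n y" "y m = None" "k0 < n" "k0 \<noteq> m" "y k0 = None"
    then show ?thesis using open_reply[OF n m] st unfolding p by blast
  next
    assume "x = [0 \<mapsto> True, 2 \<mapsto> False]" "palindromic n y" "y m \<noteq> None"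
    then show ?thesis using blocked_reply[OF n] st unfolding p by blast
  next
    fix s j assume "x = [0 \<mapsto> True, 2 \<mapsto> False]" "j < n" "j \<noteq> m"
      "\<forall>k<n. y k = (if k = m \<or> k = j then None else Some s)"
    then show ?thesis using two_gaps_reply[OF n m] st unfolding p by blast
  qed
qed

section \<open>The opening move\<close>

lemma ex_safe_opening:
  assumes "n \<ge> 4"
  shows "\<exists>I p. step n (Map.empty, Map.empty) p \<and> I p \<and> safe n I"
proof (cases "even n")
  case True
  have "step n (Map.empty, Map.empty) ([1 \<mapsto> True], Map.empty)"
    by (rule step.left) (auto simp: admissible_def chain_def)
  then show ?thesis
    by (intro exI[of _ "\<lambda>(x, y). x = [1 \<mapsto> True] \<and> palindromic n y \<and> chain n y"]
        exI[of _ "([1 \<mapsto> True], Map.empty)"] conjI win_even[OF True assms])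
      (auto simp: palindromic_def chain_def)
next
  case False
  then obtain m where n: "n = 2 * m + 1" by (elim oddE)
  then have m: "2 \<le> m" using assms by simp
  have "step n (Map.empty, Map.empty) ([0 \<mapsto> True], Map.empty)"
    by (rule step.left) (auto simp: admissible_def chain_def)
  moreover have "odd_invariant m ([0 \<mapsto> True], Map.empty)"
    using m by (simp add: odd_invariant_def palindromic_def chain_def exI[of _ 0])
  ultimately show ?thesis
    by (intro exI[of _ "odd_invariant m"] exI[of _ "([0 \<mapsto> True], Map.empty)"] conjI win_odd[OF n m])
qed

section \<open>Winning strategies from invariants\<close>

text \<open>It suffices that \<open>\<sigma>\<close> picks any good reply by Hilbert choice. After
  an even number of moves there is then no cycle cell and a legal move exists, so a play following
  \<open>\<sigma>\<close> can only finish after an odd number of moves, when Player 2 is to move and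
  has lost.\<close>

lemma winning_strategyI:
  fixes J :: "('v \<times> 'v) set \<Rightarrow> bool"
  assumes "\<not> (\<exists>F. cycle_cell G {} F)" and "legal_move G {} m\<^sub>0" and "J {m\<^sub>0}"
    and reply: "\<And>M m. J M \<Longrightarrow> \<not> (\<exists>F. cycle_cell G M F) \<Longrightarrow> legal_move G M m \<Longrightarrow>
      \<not> (\<exists>F. cycle_cell G (insert m M) F) \<and>
      (\<exists>m'. legal_move G (insert m M) m' \<and>
        ((\<exists>F. cycle_cell G (insert m' (insert m M)) F) \<or> J (insert m' (insert m M))))"
  shows "\<exists>\<sigma>. winning_strategy G Player1 \<sigma>"
proof -
  define W where "W M \<longleftrightarrow> (\<exists>F. cycle_cell G M F) \<or> J M" for M
  define good where "good ms m \<longleftrightarrow> legal_move G (set ms) m \<and> W (insert m (set ms))" for ms m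
  define \<sigma> where "\<sigma> ms = (SOME m. good ms m)" for ms
  have inv: "if even (length ms) then \<not> (\<exists>F. cycle_cell G (set ms) F) \<and> (\<exists>m. good ms m) else W (set ms)"
    if "play G ms" "follows Player1 \<sigma> ms" for ms
    using that
  proof (induction rule: play.induct)
    case start
    have "good [] m\<^sub>0" using assms(2,3) by (simp add: good_def W_def)
    then have "\<exists>m. good [] m" ..
    then show ?case using assms(1) by simp
  next
    case (move ms m)
    have "follows Player1 \<sigma> ms"
      unfolding follows_def
    proof (intro allI impI)
      fix i assume "i < length ms" "to_move (take i ms) = Player1"
      then show "ms ! i = \<sigma> (take i ms)"
        using move.prems[unfolded follows_def, rule_format, of i] by (simp add: nth_append)
    qed
    note IH = move.IH[OF this]
    show ?case
    proof (cases "even (length ms)")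
      case True
      then have "m = \<sigma> ms"
        using move.prems[unfolded follows_def, rule_format, of "length ms"] by (simp add: to_move_def)
      then have "good ms m" using IH True someI_ex[of "good ms"] by (simp add: \<sigma>_def)
      then show ?thesis using True by (simp add: good_def)
    next
      case False
      then have "J (set ms)" using IH move.hyps(2) by (auto simp: W_def)
      from reply[OF this move.hyps(2,3)] show ?thesis
        using False by (simp add: good_def W_def)
    qed
  qed
  have "winning_strategy G Player1 \<sigma>"
    unfolding winning_strategy_def
  proof (intro allI impI)
    fix ms assume "play G ms \<and> follows Player1 \<sigma> ms"
    then have i: "if even (length ms) then \<not> (\<exists>F. cycle_cell G (set ms) F) \<and> (\<exists>m. good ms m) else W (set ms)"
      using inv by blast
    show "if finished G ms then winner ms = Player1
          else to_move ms = Player1 \<longrightarrow> legal_move G (set ms) (\<sigma> ms)"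
    proof (cases "even (length ms)")
      case True
      then have "good ms (\<sigma> ms)" using i someI_ex[of "good ms"] by (simp add: \<sigma>_def)
      then show ?thesis using i True by (auto simp: finished_def good_def)
    next
      case False
      then show ?thesis by (simp add: winner_def to_move_def)
    qed
  qed
  then show ?thesis by blast
qed

section \<open>Two cycles sharing a vertex\<close>

text \<open>Index \<open>k\<close> repeats the start, so that consecutive edges need no reduction
  modulo \<open>k\<close> and the cycle appears cut open at \<open>v 0\<close>.\<close>

definition cycle_walk :: "nat \<Rightarrow> (nat \<Rightarrow> 'v) \<Rightarrow> bool" where
  "cycle_walk k v \<longleftrightarrow> 3 \<le> k \<and> inj_on v {..<k} \<and> v k = v 0"

definition walk_edges :: "nat \<Rightarrow> (nat \<Rightarrow> 'v) \<Rightarrow> 'v set set" where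
  "walk_edges k v = {{v i, v (Suc i)} | i. i < k}"

definition arrow :: "(nat \<Rightarrow> 'v) \<Rightarrow> bool \<Rightarrow> nat \<Rightarrow> 'v \<times> 'v" where
  "arrow v s i = (if s then (v i, v (Suc i)) else (v (Suc i), v i))"

definition marks :: "nat \<Rightarrow> (nat \<Rightarrow> 'v) \<Rightarrow> (nat \<Rightarrow> bool option) \<Rightarrow> ('v \<times> 'v) set" where
  "marks k v x = {arrow v s i | i s. i < k \<and> x i = Some s}"

text \<open>Rotating the list of vertices by the position \<open>p\<close> of \<open>a\<close> makes
  the walk start at \<open>a\<close>.\<close>

lemma cycle_graph_walk:
  assumes "cycle_graph k V E" and "a \<in> V"
  obtains v where "cycle_walk k v" "v 0 = a" "V = v ` {..<k}" "E = walk_edges k v"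
proof -
  from assms(1) obtain vs where k: "3 \<le> k" and vs: "length vs = k" "distinct vs" "V = set vs"
    and E: "E = {{vs ! i, vs ! (Suc i mod k)} | i. i < k}"
    by (auto simp: cycle_graph_def)
  obtain p where p: "p < k" "vs ! p = a" using assms(2) vs by (auto simp: in_set_conv_nth)
  define v where "v i = vs ! ((p + i) mod k)" for i
  have k0: "0 < k" using k by simp
  have onto: "\<exists>j<k. (p + j) mod k = i" if "i < k" for i
  proof -
    \<comment> \<open>Adding \<open>k\<close> before subtracting \<open>p\<close> keeps the
      subtraction of natural numbers exact.\<close>
    have "(p + (i + k - p) mod k) mod k = i"
      using p that by (simp add: mod_add_right_eq)
    then show ?thesis using k0 by (intro exI[of _ "(i + k - p) mod k"]) simp
  qed
  have img: "(\<lambda>i. (p + i) mod k) ` {..<k} = {..<k}"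
  proof (intro equalityI subsetI)
    fix i assume "i \<in> {..<k}"
    then show "i \<in> (\<lambda>i. (p + i) mod k) ` {..<k}" using onto[of i] by auto
  qed (use k0 in auto)
  \<comment> \<open>A map of a finite set onto itself is injective.\<close>
  have inj: "inj_on (\<lambda>i. (p + i) mod k) {..<k}"
    by (rule eq_card_imp_inj_on) (simp_all only: img finite_lessThan)
  have "inj_on v {..<k}"
  proof (rule inj_onI)
    fix i j assume ij: "i \<in> {..<k}" "j \<in> {..<k}" and "v i = v j"
    then have "vs ! ((p + i) mod k) = vs ! ((p + j) mod k)" by (simp only: v_def)
    then have "(p + i) mod k = (p + j) mod k"
      using nth_eq_iff_index_eq[OF vs(2)] vs(1) mod_less_divisor[OF k0] by metis
    then show "i = j" by (rule inj_onD[OF inj _ ij])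
  qed
  moreover have "v k = v 0" by (simp add: v_def)
  moreover have "v 0 = a" using p by (simp add: v_def)
  moreover have "V = v ` {..<k}"
  proof -
    have "V = (!) vs ` {..<k}" using vs(1,3) by (auto simp: in_set_conv_nth)
    also have "\<dots> = (!) vs ` (\<lambda>i. (p + i) mod k) ` {..<k}" by (simp only: img)
    finally show ?thesis by (simp add: v_def image_image)
  qed
  moreover have "E = walk_edges k v"
  proof -
    have "E = (\<lambda>i. {vs ! i, vs ! (Suc i mod k)}) ` {..<k}" using E by auto
    also have "\<dots> = (\<lambda>i. {vs ! i, vs ! (Suc i mod k)}) ` (\<lambda>i. (p + i) mod k) ` {..<k}" by (simp only: img)
    also have "\<dots> = (\<lambda>i. {v i, v (Suc i)}) ` {..<k}" by (simp add: v_def image_image mod_Suc_eq)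
    finally show ?thesis unfolding walk_edges_def by blast
  qed
  ultimately show ?thesis using that k by (simp add: cycle_walk_def)
qed

lemma cycle_walk_eq:
  assumes "cycle_walk k v" "i < k" "j < k"
  shows "v i = v j \<longleftrightarrow> i = j"
    and "v i = v (Suc j) \<longleftrightarrow> i = Suc j \<or> i = 0 \<and> Suc j = k"
    and "v (Suc i) = v (Suc j) \<longleftrightarrow> i = j"
proof -
  have inj: "v i = v j \<longleftrightarrow> i = j" if "i < k" "j < k" for i j
    using assms(1) that by (auto simp: cycle_walk_def inj_on_def)
  have vk: "v k = v 0" "0 < k" using assms(1) by (auto simp: cycle_walk_def)
  show "v i = v j \<longleftrightarrow> i = j" using inj assms by blast
  have s: "v i = v (Suc j) \<longleftrightarrow> i = Suc j \<or> i = 0 \<and> Suc j = k" if "i < k" "j < k" for i j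
  proof (cases "Suc j = k")
    case True
    then show ?thesis using inj[OF that(1) vk(2)] vk that by auto
  next
    case False
    then show ?thesis using inj[of i "Suc j"] that by auto
  qed
  show "v i = v (Suc j) \<longleftrightarrow> i = Suc j \<or> i = 0 \<and> Suc j = k" using s assms by blast
  show "v (Suc i) = v (Suc j) \<longleftrightarrow> i = j"
  proof (cases "Suc i = k")
    case True
    then show ?thesis using s[OF vk(2) assms(3)] vk assms by auto
  next
    case False
    then show ?thesis using s[of "Suc i" j] assms by auto
  qed
qed

text \<open>Two different steps could traverse one edge in opposite directions only in a closed walk
  of length at most 2.\<close>

lemma walk_edge_inj:
  assumes "cycle_walk k v" "i < k" "j < k"
  shows "{v i, v (Suc i)} = {v j, v (Suc j)} \<longleftrightarrow> i = j"
proof -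
  have "3 \<le> k" using assms(1) by (simp add: cycle_walk_def)
  moreover have "v (Suc i) = v j \<longleftrightarrow> j = Suc i \<or> j = 0 \<and> Suc i = k"
    using cycle_walk_eq(2)[OF assms(1,3,2)] by metis
  ultimately show ?thesis
    unfolding doubleton_eq_iff cycle_walk_eq[OF assms] by auto
qed

section \<open>Arrows and markings on one walk\<close>

lemma arrow_edge: "{fst (arrow v s i), snd (arrow v s i)} = {v i, v (Suc i)}"
  by (auto simp: arrow_def)

lemma edge_arrow: "{p, q} = {v i, v (Suc i)} \<Longrightarrow> \<exists>s. (p, q) = arrow v s i"
  by (auto simp: arrow_def doubleton_eq_iff)

lemma arrow_inj:
  assumes "cycle_walk k v" "i < k" "j < k"
  shows "arrow v s i = arrow v t j \<longleftrightarrow> i = j \<and> s = t"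
proof
  assume e: "arrow v s i = arrow v t j"
  then have ij: "i = j" using walk_edge_inj[OF assms] by (metis arrow_edge)
  have "v i \<noteq> v (Suc i)" using cycle_walk_eq(2)[OF assms(1,2,2)] assms(1) by (auto simp: cycle_walk_def)
  then show "i = j \<and> s = t" using e ij by (auto simp: arrow_def split: if_splits)
qed simp

lemma arrow_in_marks:
  assumes "cycle_walk k v" "i < k"
  shows "arrow v s i \<in> marks k v x \<longleftrightarrow> x i = Some s"
  using assms arrow_inj[OF assms(1)] unfolding marks_def by auto

lemma marks_edge:
  assumes "(p, q) \<in> marks k v x"
  shows "{p, q} \<in> walk_edges k v"
proof -
  from assms obtain i s where i: "i < k" "(p, q) = arrow v s i" by (auto simp: marks_def)
  then have "{p, q} = {v i, v (Suc i)}" by (metis arrow_edge fst_conv snd_conv)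
  with i show ?thesis by (auto simp: walk_edges_def)
qed

lemma marks_upd:
  assumes "i < k" "x i = None"
  shows "marks k v (x(i \<mapsto> s)) = insert (arrow v s i) (marks k v x)"
proof (intro equalityI subsetI)
  fix m assume "m \<in> marks k v (x(i \<mapsto> s))"
  then obtain j t where "j < k" "m = arrow v t j" "(x(i \<mapsto> s)) j = Some t"
    unfolding marks_def by blast
  then show "m \<in> insert (arrow v s i) (marks k v x)"
    by (cases "j = i") (auto simp: marks_def)
next
  fix m assume "m \<in> insert (arrow v s i) (marks k v x)"
  then consider "m = arrow v s i" | j t where "j < k" "m = arrow v t j" "x j = Some t"
    unfolding marks_def by blast
  then show "m \<in> marks k v (x(i \<mapsto> s))"
  proof cases
    case 1
    then show ?thesis using assms by (auto simp: marks_def)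
  next
    case 2
    then have "j \<noteq> i" using assms by auto
    with 2 show ?thesis unfolding marks_def by (simp, metis)
  qed
qed

lemma walk_edges_at_Suc:
  assumes "cycle_walk k v" "Suc i < k"
  shows "{u, v (Suc i)} \<in> walk_edges k v \<longleftrightarrow> u = v i \<or> u = v (Suc (Suc i))"
proof
  assume "{u, v (Suc i)} \<in> walk_edges k v"
  then obtain j where j: "j < k" "{u, v (Suc i)} = {v j, v (Suc j)}" by (auto simp: walk_edges_def)
  then have "u = v j \<and> v (Suc i) = v (Suc j) \<or> u = v (Suc j) \<and> v (Suc i) = v j"
    by (simp only: doubleton_eq_iff)
  then show "u = v i \<or> u = v (Suc (Suc i))"
    using cycle_walk_eq(1)[OF assms(1,2) j(1)] cycle_walk_eq(2)[OF assms(1,2) j(1)] by blast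
next
  show "u = v i \<or> u = v (Suc (Suc i)) \<Longrightarrow> {u, v (Suc i)} \<in> walk_edges k v"
    using assms(2) unfolding walk_edges_def by (auto simp: insert_commute intro: Suc_lessD)
qed

lemma walk_edges_at_0:
  assumes "cycle_walk k v"
  shows "{u, v 0} \<in> walk_edges k v \<longleftrightarrow> u = v (Suc 0) \<or> u = v (k - 1)"
proof
  have k: "0 < k" using assms by (simp add: cycle_walk_def)
  assume "{u, v 0} \<in> walk_edges k v"
  then obtain j where j: "j < k" "{u, v 0} = {v j, v (Suc j)}" by (auto simp: walk_edges_def)
  then have "u = v j \<and> v 0 = v (Suc j) \<or> u = v (Suc j) \<and> v 0 = v j"
    by (simp only: doubleton_eq_iff)
  then show "u = v (Suc 0) \<or> u = v (k - 1)"
    using cycle_walk_eq(1)[OF assms k j(1)] cycle_walk_eq(2)[OF assms k j(1)]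
    by (metis diff_Suc_1 nat.distinct(1))
next
  have "v 0 = v (Suc (k - 1))" "k - 1 < k" "0 < k" using assms by (auto simp: cycle_walk_def)
  then show "u = v (Suc 0) \<or> u = v (k - 1) \<Longrightarrow> {u, v 0} \<in> walk_edges k v"
    unfolding walk_edges_def by (force simp: insert_commute)
qed

text \<open>Separates the two ways in which neighbours can disagree; in the graph they are a sink
  and a source at the vertex between the two edges.\<close>

lemma chain_iff:
  "chain k x \<longleftrightarrow> (\<forall>i. Suc i < k \<longrightarrow> \<not> (x i = Some True \<and> x (Suc i) = Some False) \<and>
     \<not> (x i = Some False \<and> x (Suc i) = Some True))"
  by (simp add: chain_def all_bool_eq)

text \<open>Both lengths are arbitrary, which makes the assumptions symmetric: \<open>swap\<close>
  transfers whatever is proved for \<open>v\<close> to \<open>w\<close>.\<close>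

locale two_cycles =
  fixes G :: "'v board" and k l :: nat and v w :: "nat \<Rightarrow> 'v"
  assumes plane: "plane_board G"
    and v: "cycle_walk k v" and w: "cycle_walk l w" and vw0: "w 0 = v 0"
    and verts: "verts G = v ` {..<k} \<union> w ` {..<l}"
    and common: "v ` {..<k} \<inter> w ` {..<l} = {v 0}"
    and edges: "edges G = walk_edges k v \<union> walk_edges l w"
    and disj: "walk_edges k v \<inter> walk_edges l w = {}"
begin

definition marking :: "(nat \<Rightarrow> bool option) \<Rightarrow> (nat \<Rightarrow> bool option) \<Rightarrow> ('v \<times> 'v) set" where
  "marking x y = marks k v x \<union> marks l w y"

lemma swap: "two_cycles G l k w v"
  using plane v w vw0 verts common edges disj by unfold_locales auto

lemma swap_marking: "two_cycles.marking l k w v y x = marking x y"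
  by (simp add: marking_def two_cycles.marking_def[OF swap] Un_commute)

text \<open>An arrow on an edge of \<open>v\<close> cannot stem from \<open>y\<close>, because the
  two walks share no edge.\<close>

lemma arrow_in_marking:
  assumes "i < k"
  shows "arrow v s i \<in> marking x y \<longleftrightarrow> x i = Some s"
proof -
  have "arrow v s i \<notin> marks l w y"
  proof
    assume "arrow v s i \<in> marks l w y"
    then have "{v i, v (Suc i)} \<in> walk_edges l w"
      using marks_edge[of "fst (arrow v s i)" "snd (arrow v s i)" l w y] by (simp add: arrow_edge)
    then show False using assms disj by (auto simp: walk_edges_def)
  qed
  then show ?thesis using arrow_in_marks[OF v assms] by (auto simp: marking_def)
qed

lemma marked_marking:
  assumes "i < k"
  shows "marked (marking x y) {v i, v (Suc i)} \<longleftrightarrow> x i \<noteq> None"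
proof
  assume "marked (marking x y) {v i, v (Suc i)}"
  then obtain p q where pq: "{p, q} = {v i, v (Suc i)}" "(p, q) \<in> marking x y"
    by (auto simp: marked_def)
  then show "x i \<noteq> None" using edge_arrow[OF pq(1)] arrow_in_marking[OF assms] by auto
next
  assume "x i \<noteq> None"
  then obtain s where "arrow v s i \<in> marking x y" using arrow_in_marking[OF assms] by auto
  then show "marked (marking x y) {v i, v (Suc i)}"
    unfolding marked_def by (metis arrow_edge prod.collapse)
qed

lemma pair_in_marking:
  assumes "i < k"
  shows "(v i, v (Suc i)) \<in> marking x y \<longleftrightarrow> x i = Some True"
    and "(v (Suc i), v i) \<in> marking x y \<longleftrightarrow> x i = Some False"
  using arrow_in_marking[OF assms, of True] arrow_in_marking[OF assms, of False]
  by (auto simp: arrow_def)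

section \<open>Sinks and sources in terms of words\<close>

lemma edges_at_Suc:
  assumes "Suc i < k"
  shows "{u, v (Suc i)} \<in> edges G \<longleftrightarrow> u = v i \<or> u = v (Suc (Suc i))"
proof -
  have "v (Suc i) \<noteq> v 0" using cycle_walk_eq(1)[OF v assms, of 0] assms by auto
  then have "v (Suc i) \<notin> w ` {..<l}" using common assms by blast
  moreover have "w (Suc j) \<in> w ` {..<l}" if "j < l" for j
    using that w by (cases "Suc j = l") (auto simp: cycle_walk_def)
  ultimately have "{u, v (Suc i)} \<noteq> {w j, w (Suc j)}" if "j < l" for j
    using that by (metis doubleton_eq_iff imageI lessThan_iff)
  then have "{u, v (Suc i)} \<notin> walk_edges l w" unfolding walk_edges_def by blast
  then show ?thesis unfolding edges using walk_edges_at_Suc[OF v assms, of u] by blast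
qed

lemma extremal_Suc:
  assumes "Suc i < k"
  shows "sink G (marking x y) (v (Suc i)) \<longleftrightarrow> x i = Some True \<and> x (Suc i) = Some False"
    and "source G (marking x y) (v (Suc i)) \<longleftrightarrow> x i = Some False \<and> x (Suc i) = Some True"
proof -
  have e: "(\<forall>u. {u, v (Suc i)} \<in> edges G \<longrightarrow> P u) \<longleftrightarrow> P (v i) \<and> P (v (Suc (Suc i)))" for P
    unfolding edges_at_Suc[OF assms] by blast
  have V: "v (Suc i) \<in> verts G" unfolding verts using assms by blast
  note m = pair_in_marking[OF assms] pair_in_marking[OF Suc_lessD[OF assms]]
  show "sink G (marking x y) (v (Suc i)) \<longleftrightarrow> x i = Some True \<and> x (Suc i) = Some False"
    unfolding sink_def e m using V by blast
  show "source G (marking x y) (v (Suc i)) \<longleftrightarrow> x i = Some False \<and> x (Suc i) = Some True"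
    unfolding source_def e m using V by blast
qed

text \<open>The first and the last edge of each walk meet at \<open>v 0\<close>. One direction along
  the walk leaves \<open>v 0\<close> on the first edge and enters it on the last, hence the opposite
  signs within each word.\<close>

lemma extremal_0:
  shows "sink G (marking x y) (v 0) \<longleftrightarrow>
      x 0 = Some False \<and> x (k - 1) = Some True \<and> y 0 = Some False \<and> y (l - 1) = Some True"
    and "source G (marking x y) (v 0) \<longleftrightarrow>
      x 0 = Some True \<and> x (k - 1) = Some False \<and> y 0 = Some True \<and> y (l - 1) = Some False"
proof -
  interpret s: two_cycles G l k w v by (rule swap)
  have k: "0 < k" "k - 1 < k" "v (Suc (k - 1)) = v 0" and l: "0 < l" "l - 1 < l" "w (Suc (l - 1)) = v 0"
    using v w vw0 by (auto simp: cycle_walk_def)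
  have "{u, v 0} \<in> edges G \<longleftrightarrow> u = v (Suc 0) \<or> u = v (k - 1) \<or> u = w (Suc 0) \<or> u = w (l - 1)" for u
    unfolding edges Un_iff walk_edges_at_0[OF v] walk_edges_at_0[OF w, unfolded vw0] by blast
  then have e: "(\<forall>u. {u, v 0} \<in> edges G \<longrightarrow> P u) \<longleftrightarrow>
      P (v (Suc 0)) \<and> P (v (k - 1)) \<and> P (w (Suc 0)) \<and> P (w (l - 1))" for P
    by (simp only:) blast
  have m: "(v 0, v (Suc 0)) \<in> marking x y \<longleftrightarrow> x 0 = Some True"
    "(v (Suc 0), v 0) \<in> marking x y \<longleftrightarrow> x 0 = Some False"
    "(v (k - 1), v 0) \<in> marking x y \<longleftrightarrow> x (k - 1) = Some True"
    "(v 0, v (k - 1)) \<in> marking x y \<longleftrightarrow> x (k - 1) = Some False"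
    "(v 0, w (Suc 0)) \<in> marking x y \<longleftrightarrow> y 0 = Some True"
    "(w (Suc 0), v 0) \<in> marking x y \<longleftrightarrow> y 0 = Some False"
    "(w (l - 1), v 0) \<in> marking x y \<longleftrightarrow> y (l - 1) = Some True"
    "(v 0, w (l - 1)) \<in> marking x y \<longleftrightarrow> y (l - 1) = Some False"
    using pair_in_marking[OF k(1), of x y] pair_in_marking[OF k(2), of x y, unfolded k(3)]
      s.pair_in_marking[OF l(1), of y x] s.pair_in_marking[OF l(2), of y x, unfolded l(3)]
    by (simp_all add: vw0 swap_marking)
  have v0: "v 0 \<in> verts G" unfolding verts using k(1) by blast
  show "sink G (marking x y) (v 0) \<longleftrightarrow>
      x 0 = Some False \<and> x (k - 1) = Some True \<and> y 0 = Some False \<and> y (l - 1) = Some True"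
    using v0 unfolding sink_def e m by blast
  show "source G (marking x y) (v 0) \<longleftrightarrow>
      x 0 = Some True \<and> x (k - 1) = Some False \<and> y 0 = Some True \<and> y (l - 1) = Some False"
    using v0 unfolding source_def e m by blast
qed

lemma no_extremal_iff:
  "(\<forall>u. \<not> sink G (marking x y) u \<and> \<not> source G (marking x y) u) \<longleftrightarrow>
     chain k x \<and> chain l y \<and>
     (\<forall>s. \<not> (x 0 = Some s \<and> x (k - 1) = Some (\<not> s) \<and> y 0 = Some s \<and> y (l - 1) = Some (\<not> s)))"
proof -
  interpret s: two_cycles G l k w v by (rule swap)
  let ?ok = "\<lambda>u. \<not> sink G (marking x y) u \<and> \<not> source G (marking x y) u"
  have out: "\<forall>u. u \<notin> verts G \<longrightarrow> ?ok u"
    by (simp add: sink_def source_def)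
  have V: "u \<in> verts G \<longleftrightarrow> u = v 0 \<or> (\<exists>i. Suc i < k \<and> u = v (Suc i)) \<or> (\<exists>i. Suc i < l \<and> u = w (Suc i))" for u
  proof -
    have "u \<in> f ` {..<n} \<longleftrightarrow> u = f 0 \<or> (\<exists>i. Suc i < n \<and> u = f (Suc i))" if "0 < n" for f :: "nat \<Rightarrow> 'v" and n
    proof -
      have "u \<in> f ` {..<n} \<longleftrightarrow> (\<exists>i<n. u = f i)" by blast
      also have "\<dots> \<longleftrightarrow> u = f 0 \<or> (\<exists>i. Suc i < n \<and> u = f (Suc i))"
        using that by (metis not0_implies_Suc)
      finally show ?thesis .
    qed
    moreover have "0 < k" "0 < l" using v w by (auto simp: cycle_walk_def)
    ultimately show ?thesis unfolding verts Un_iff using vw0 by simp blast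
  qed
  have c: "chain k x \<longleftrightarrow> (\<forall>i. Suc i < k \<longrightarrow> ?ok (v (Suc i)))"
    by (simp add: chain_iff extremal_Suc)
  have d: "chain l y \<longleftrightarrow> (\<forall>i. Suc i < l \<longrightarrow> ?ok (w (Suc i)))"
    using s.extremal_Suc[of _ y x] unfolding swap_marking by (simp add: chain_iff)
  \<comment> \<open>\<open>s = True\<close> describes a source at \<open>v 0\<close>, and
    \<open>s = False\<close> a sink.\<close>
  have a: "(\<forall>s. \<not> (x 0 = Some s \<and> x (k - 1) = Some (\<not> s) \<and> y 0 = Some s \<and> y (l - 1) = Some (\<not> s))) \<longleftrightarrow> ?ok (v 0)"
    unfolding extremal_0 all_bool_eq by simp blast
  have all_iff: "(\<forall>u. Q u) \<longleftrightarrow> Q (v 0) \<and> (\<forall>i. Suc i < k \<longrightarrow> Q (v (Suc i))) \<and> (\<forall>i. Suc i < l \<longrightarrow> Q (w (Suc i)))"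
    if "\<forall>u. u \<notin> verts G \<longrightarrow> Q u" for Q
    using that V by metis
  from all_iff[of ?ok, OF out] show ?thesis unfolding c d a by (simp only: conj_ac)
qed

end

section \<open>Cells and winding numbers\<close>

text \<open>Joins the \<open>i + 1\<close> curves \<open>c 0\<close> to \<open>c i\<close>. Starting
  from \<open>c 0\<close> rather than from a constant path allows the result to be an arc.\<close>

primrec joined :: "(nat \<Rightarrow> real \<Rightarrow> complex) \<Rightarrow> nat \<Rightarrow> real \<Rightarrow> complex" where
  "joined c 0 = c 0"
| "joined c (Suc i) = joined c i +++ c (Suc i)"

text \<open>The first letter propagates from neighbour to neighbour, so a filled cycle is oriented
  consistently.\<close>

lemma chain_full_const:
  assumes "chain k x" "full k x"
  shows "\<exists>s. \<forall>i<k. x i = Some s"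
proof (cases "k = 0")
  case False
  then obtain s where s: "x 0 = Some s" using assms(2) unfolding full_def by blast
  have "x i = Some s" if "i < k" for i
    using that
  proof (induction i)
    case (Suc i)
    obtain t where "x (Suc i) = Some t" using assms(2) Suc.prems unfolding full_def by blast
    moreover have "x i = Some s" using Suc by simp
    ultimately show ?case using chainD[OF assms(1) Suc.prems, of s t] by simp
  qed (rule s)
  then show ?thesis by blast
qed simp

section \<open>Each cycle as a Jordan curve\<close>

context two_cycles
begin

abbreviation side :: "nat \<Rightarrow> real \<Rightarrow> complex" where
  "side i \<equiv> curve G (v i) (v (Suc i))"

lemma edge_curve:
  assumes "{p, q} \<in> edges G"
  shows "arc (curve G p q)" "pathstart (curve G p q) = pos G p" "pathfinish (curve G p q) = pos G q"
    "curve G q p = reversepath (curve G p q)"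
  using plane assms unfolding plane_board_def by blast+

lemma side_edge: "i < k \<Longrightarrow> {v i, v (Suc i)} \<in> edges G"
  using edges by (auto simp: walk_edges_def)

lemma side_curve:
  assumes "i < k"
  shows "arc (side i)" "pathstart (side i) = pos G (v i)" "pathfinish (side i) = pos G (v (Suc i))"
    "curve G (v (Suc i)) (v i) = reversepath (side i)"
  using edge_curve[OF side_edge[OF assms]] by auto

lemma curve_Int:
  assumes "{p, q} \<in> edges G" "{r, s} \<in> edges G" "{p, q} \<noteq> {r, s}"
  shows "path_image (curve G p q) \<inter> path_image (curve G r s) \<subseteq> pos G ` ({p, q} \<inter> {r, s})"
  using plane assms unfolding plane_board_def by blast

lemma edges_drawing_walk: "edges_drawing G (walk_edges k v) = (\<Union>i<k. path_image (side i))"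
proof -
  have "path_image (curve G p q) = path_image (side i)" if "i < k" "{p, q} = {v i, v (Suc i)}" for p q i
    using that(2) side_curve(4)[OF that(1)] unfolding doubleton_eq_iff
    by (metis path_image_reversepath)
  then show ?thesis unfolding edges_drawing_def walk_edges_def by blast
qed

text \<open>At least one side is left out, so each new side ends in a new vertex and meets the
  earlier sides at most in the vertex where it is attached.\<close>

lemma joined_sides:
  assumes "Suc i < k"
  shows "arc (joined side i) \<and> pathstart (joined side i) = pos G (v 0) \<and>
    pathfinish (joined side i) = pos G (v (Suc i)) \<and>
    path_image (joined side i) = (\<Union>j\<le>i. path_image (side j))"
  using assms
proof (induction i)
  case 0
  then show ?case using side_curve[of 0] by auto
next
  case (Suc i)
  then have i: "Suc i < k" by simp
  note IH = Suc.IH[OF i] and c = side_curve[OF i]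
  have "path_image (side j) \<inter> path_image (side (Suc i)) \<subseteq> {pos G (v (Suc i))}" if "j \<le> i" for j
  proof -
    have j: "j < k" "j \<noteq> Suc i" using that i by auto
    then have "path_image (side j) \<inter> path_image (side (Suc i)) \<subseteq>
        pos G ` ({v j, v (Suc j)} \<inter> {v (Suc i), v (Suc (Suc i))})"
      using curve_Int[OF side_edge[OF j(1)] side_edge[OF i]] walk_edge_inj[OF v j(1) i] by blast
    moreover have "v (Suc (Suc i)) \<noteq> v j" "v (Suc (Suc i)) \<noteq> v (Suc j)"
      using cycle_walk_eq[OF v Suc.prems j(1)] that by auto
    ultimately show ?thesis by auto
  qed
  then have "path_image (joined side i) \<inter> path_image (side (Suc i)) \<subseteq> {pathstart (side (Suc i))}"
    using IH c by auto
  then have "arc (joined side (Suc i))" using IH c by (auto intro!: arc_join)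
  moreover have "path_image (joined side (Suc i)) = (\<Union>j\<le>Suc i. path_image (side j))"
    using IH c by (auto simp: path_image_join atMost_Suc)
  ultimately show ?case using IH c by simp
qed

text \<open>The last side meets the arc formed by the others only at its two ends, which yields a
  Jordan curve. Winding numbers add up along the pieces; up to sign, this sum will be
  \<open>boundary_winding\<close>.\<close>

lemma boundary_loop:
  obtains g where "simple_path g" "pathfinish g = pathstart g"
    "path_image g = edges_drawing G (walk_edges k v)"
    "\<And>z. z \<notin> edges_drawing G (walk_edges k v) \<Longrightarrow> winding_number g z = (\<Sum>i<k. winding_number (side i) z)"
proof -
  \<comment> \<open>Sides \<open>0\<close> to \<open>m\<close> form the arc, and side
    \<open>Suc m\<close> closes it.\<close>
  obtain m where m: "k = Suc (Suc m)" using v by (auto simp: cycle_walk_def numeral_3_eq_3 le_Suc_eq dest: Suc_le_D)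
  let ?g = "joined side (Suc m)"
  have l: "Suc m < k" and vk: "v k = v 0" using m v by (auto simp: cycle_walk_def)
  note J = joined_sides[OF l] and c = side_curve[OF l]
  have "path_image (side j) \<inter> path_image (side (Suc m)) \<subseteq> {pos G (v 0), pos G (v (Suc m))}" if "j \<le> m" for j
  proof -
    have j: "j < k" "j \<noteq> Suc m" using that l by auto
    then have "path_image (side j) \<inter> path_image (side (Suc m)) \<subseteq>
        pos G ` ({v j, v (Suc j)} \<inter> {v (Suc m), v (Suc (Suc m))})"
      using curve_Int[OF side_edge[OF j(1)] side_edge[OF l]] walk_edge_inj[OF v j(1) l] by blast
    then show ?thesis using vk m by auto
  qed
  then have "path_image (joined side m) \<inter> path_image (side (Suc m)) \<subseteq>
      {pathstart (joined side m), pathstart (side (Suc m))}"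
    using J c by auto
  then have "simple_path ?g"
    unfolding joined.simps using J c vk m by (intro simple_path_join_loop) auto
  moreover have "pathfinish ?g = pathstart ?g" using J c vk m by simp
  moreover have img: "path_image ?g = edges_drawing G (walk_edges k v)"
    using J c unfolding edges_drawing_walk unfolding m
    by (auto simp: path_image_join lessThan_Suc_atMost atMost_Suc)
  moreover have "winding_number ?g z = (\<Sum>i<k. winding_number (side i) z)"
    if z: "z \<notin> edges_drawing G (walk_edges k v)" for z
  proof -
    have zi: "z \<notin> path_image (side i)" if "i < k" for i
      using z that unfolding edges_drawing_walk by auto
    have "winding_number (joined side i) z = (\<Sum>j\<le>i. winding_number (side j) z)" if "i < k" for i
      using that
    proof (induction i)
      case (Suc i)
      note Ji = joined_sides[OF Suc.prems] and ci = side_curve[OF Suc.prems]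
      have "z \<notin> path_image (joined side i)" using Ji zi Suc.prems by auto
      then have "winding_number (joined side (Suc i)) z =
          winding_number (joined side i) z + winding_number (side (Suc i)) z"
        unfolding joined.simps using Ji ci zi[OF Suc.prems]
        by (intro winding_number_join) (auto simp: arc_imp_path)
      then show ?case using Suc by simp
    qed simp
    from this[OF l] show ?thesis by (simp add: m lessThan_Suc_atMost)
  qed
  ultimately show ?thesis using that by blast
qed


section \<open>The two Jordan curves inside the drawing\<close>

lemma compact_boundary: "compact (edges_drawing G (walk_edges k v))"
  using boundary_loop compact_simple_path_image by metis

lemma walk_vertex: "i \<le> k \<Longrightarrow> v i \<in> v ` {..<k}"
  using v by (cases "i = k") (auto simp: cycle_walk_def)

lemma pos_in_boundary:
  assumes "u \<in> v ` {..<k}"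
  shows "pos G u \<in> edges_drawing G (walk_edges k v)"
proof -
  from assms obtain i where i: "i < k" "u = v i" by blast
  then have "pos G u \<in> path_image (side i)"
    using side_curve(2) by (metis pathstart_in_path_image)
  then show ?thesis unfolding edges_drawing_walk using i(1) by blast
qed

lemma drawing_eq: "drawing G = edges_drawing G (walk_edges k v) \<union> edges_drawing G (walk_edges l w)"
proof -
  interpret s: two_cycles G l k w v by (rule swap)
  have "edges_drawing G (A \<union> B) = edges_drawing G A \<union> edges_drawing G B" for A B
    unfolding edges_drawing_def by blast
  then show ?thesis
    unfolding drawing_def edges verts using pos_in_boundary s.pos_in_boundary by auto
qed

lemma boundary_Int:
  "edges_drawing G (walk_edges k v) \<inter> edges_drawing G (walk_edges l w) = {pos G (v 0)}"
proof
  interpret s: two_cycles G l k w v by (rule swap)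
  have "path_image (side i) \<inter> path_image (s.side j) \<subseteq> {pos G (v 0)}" if "i < k" "j < l" for i j
  proof -
    have "{v i, v (Suc i)} \<in> walk_edges k v" "{w j, w (Suc j)} \<in> walk_edges l w"
      using that by (auto simp: walk_edges_def)
    then have ne: "{v i, v (Suc i)} \<noteq> {w j, w (Suc j)}" using disj by (metis IntI empty_iff)
    have "{v i, v (Suc i)} \<inter> {w j, w (Suc j)} \<subseteq> {v 0}"
    proof -
      have "{v i, v (Suc i)} \<subseteq> v ` {..<k}" "{w j, w (Suc j)} \<subseteq> w ` {..<l}"
        using walk_vertex s.walk_vertex that by (simp_all add: Suc_le_eq)
      then show ?thesis using common by blast
    qed
    then have "pos G ` ({v i, v (Suc i)} \<inter> {w j, w (Suc j)}) \<subseteq> {pos G (v 0)}" by fastforce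
    with curve_Int[OF side_edge[OF that(1)] s.side_edge[OF that(2)] ne]
    show ?thesis by (rule subset_trans)
  qed
  then show "edges_drawing G (walk_edges k v) \<inter> edges_drawing G (walk_edges l w) \<subseteq> {pos G (v 0)}"
    unfolding edges_drawing_walk s.edges_drawing_walk by blast
  show "{pos G (v 0)} \<subseteq> edges_drawing G (walk_edges k v) \<inter> edges_drawing G (walk_edges l w)"
    using pos_in_boundary[OF walk_vertex[of 0]] s.pos_in_boundary[OF s.walk_vertex[of 0]] vw0 by simp
qed

text \<open>An edge of the other cycle lying in the frontier would be contained in the single point
  common to both curves, whereas an arc has two distinct ends.\<close>

lemma boundary_edges_eq:
  assumes "frontier F = edges_drawing G (walk_edges k v)"
  shows "boundary_edges G F = walk_edges k v"
proof
  show "walk_edges k v \<subseteq> boundary_edges G F"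
    unfolding boundary_edges_def assms edges edges_drawing_def by blast
  interpret s: two_cycles G l k w v by (rule swap)
  show "boundary_edges G F \<subseteq> walk_edges k v"
  proof
    fix e assume e: "e \<in> boundary_edges G F"
    show "e \<in> walk_edges k v"
    proof (rule ccontr)
      assume "e \<notin> walk_edges k v"
      then obtain j where j: "j < l" "e = {w j, w (Suc j)}"
        using e unfolding boundary_edges_def edges walk_edges_def by blast
      have "path_image (s.side j) \<subseteq> edges_drawing G {e}"
        unfolding edges_drawing_def j by blast
      moreover have "edges_drawing G {e} \<subseteq> edges_drawing G (walk_edges k v)"
        using e unfolding boundary_edges_def assms by blast
      moreover have "path_image (s.side j) \<subseteq> edges_drawing G (walk_edges l w)"
        unfolding s.edges_drawing_walk using j by blast
      ultimately have "path_image (s.side j) \<subseteq> {pos G (v 0)}" using boundary_Int by blast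
      then show False
        using arc_distinct_ends[OF s.side_curve(1)[OF j(1)]]
          pathstart_in_path_image[of "s.side j"] pathfinish_in_path_image[of "s.side j"] by (metis singletonD subsetD)
    qed
  qed
qed

text \<open>A connected set that avoids the frontier of \<open>F\<close> lies in \<open>F\<close> or
  is disjoint from it. The outside of the curve is unbounded, hence disjoint from \<open>F\<close>.
  So \<open>F\<close> lies in the inside, which is connected, meets \<open>F\<close> and therefore
  lies in \<open>F\<close>.\<close>

lemma cell_eq_inside:
  assumes F: "F \<in> cells G" and fr: "frontier F = edges_drawing G (walk_edges k v)"
  shows "F = inside (edges_drawing G (walk_edges k v))"
proof -
  let ?J = "edges_drawing G (walk_edges k v)"
  obtain g where g: "simple_path g" "pathfinish g = pathstart g" "path_image g = ?J"
    using boundary_loop by metis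
  note Jordan = Jordan_inside_outside[OF g(1,2), unfolded g(3)]
  have F': "connected F" "F \<noteq> {}" "bounded F" "F \<subseteq> - ?J"
    using F in_components_connected in_components_nonempty in_components_subset drawing_eq
    unfolding cells_def by blast+
  have sub: "C \<subseteq> F" if "connected C" "C \<inter> ?J = {}" "C \<inter> F \<noteq> {}" for C
    using connected_Int_frontier[of C F] that fr by blast
  have "outside ?J \<inter> F = {}"
    using sub[of "outside ?J"] Jordan F'(3) bounded_subset by blast
  then have "F \<subseteq> inside ?J" using F'(4) Jordan by blast
  then show ?thesis using sub[of "inside ?J"] Jordan F'(2) by blast
qed

text \<open>A third cell would lie outside both curves. Each of its points can be joined to a point
  \<open>y\<close> that is outside both curves and not in the cell, while avoiding either curve
  alone. The curves meet in one point, a connected set, so by Janiszewski both can be avoided at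
  once, which puts \<open>y\<close> into the cell.\<close>

lemma cells_subset:
  assumes "F\<^sub>v \<in> cells G" "frontier F\<^sub>v = edges_drawing G (walk_edges k v)"
    and "F\<^sub>w \<in> cells G" "frontier F\<^sub>w = edges_drawing G (walk_edges l w)"
  shows "cells G \<subseteq> {F\<^sub>v, F\<^sub>w}"
proof
  interpret s: two_cycles G l k w v by (rule swap)
  let ?J = "edges_drawing G (walk_edges k v)" and ?K = "edges_drawing G (walk_edges l w)"
  obtain g where g: "simple_path g" "pathfinish g = pathstart g" "path_image g = ?J"
    using boundary_loop by metis
  note gJ = Jordan_inside_outside[OF g(1,2), unfolded g(3)]
  obtain h where h: "simple_path h" "pathfinish h = pathstart h" "path_image h = ?K"
    using s.boundary_loop by metis
  note hK = Jordan_inside_outside[OF h(1,2), unfolded h(3)]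
  fix F assume F: "F \<in> cells G"
  show "F \<in> {F\<^sub>v, F\<^sub>w}"
  proof (rule ccontr)
    assume ne: "F \<notin> {F\<^sub>v, F\<^sub>w}"
    have comp: "F \<in> components (- (?J \<union> ?K))" and bF: "bounded F"
      using F by (auto simp: cells_def drawing_eq)
    have "F \<inter> F\<^sub>v = {}" "F \<inter> F\<^sub>w = {}"
      using assms(1,3) F ne components_nonoverlap unfolding cells_def by blast+
    then have dis: "F \<inter> inside ?J = {}" "F \<inter> inside ?K = {}"
      using cell_eq_inside[OF assms(1,2)] s.cell_eq_inside[OF assms(3,4)] by auto
    obtain z where z: "z \<in> F" using in_components_nonempty[OF comp] by blast
    note U = inside_Un_outside[of ?J] inside_Un_outside[of ?K]
    have "z \<in> - (?J \<union> ?K)" using in_components_subset[OF comp] z by (rule subsetD)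
    then have zo: "z \<in> outside ?J" "z \<in> outside ?K"
      using z dis U by blast+
    have "bounded (inside ?J)" "bounded (inside ?K)" using gJ hK by simp_all
    moreover have "bounded ?J" "bounded ?K"
      using compact_boundary s.compact_boundary by (simp_all add: compact_imp_bounded)
    ultimately have "bounded (F \<union> inside ?J \<union> inside ?K \<union> ?J \<union> ?K)"
      using bF by simp
    then have "F \<union> inside ?J \<union> inside ?K \<union> ?J \<union> ?K \<noteq> UNIV"
      by (metis not_bounded_UNIV)
    then obtain y where y: "y \<notin> F" "y \<in> outside ?J" "y \<in> outside ?K"
      using U by blast
    have "connected (outside ?J)" "connected (outside ?K)" using gJ hK by simp_all
    moreover have "outside ?J \<subseteq> - ?J" "outside ?K \<subseteq> - ?K" using U by blast+
    ultimately have zy: "connected_component (- ?J) z y" "connected_component (- ?K) z y"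
      unfolding connected_component_def using zo y by metis+
    have "connected_component (- (?J \<union> ?K)) z y"
    proof (rule Janiszewski)
      show "compact ?J" by (rule compact_boundary)
      show "closed ?K" by (rule compact_imp_closed[OF s.compact_boundary])
      show "connected (?J \<inter> ?K)" unfolding boundary_Int by simp
    qed (rule zy)+
    moreover obtain u where "F = connected_component_set (- (?J \<union> ?K)) u"
      using comp unfolding components_iff by blast
    ultimately have "y \<in> F" using z by (auto intro: connected_component_trans)
    then show False using y(1) by simp
  qed
qed

text \<open>If all edges are marked, the word is constant, so the arrows run once around the Jordan
  curve in the direction \<open>s\<close>, and \<open>boundary_winding\<close> is the winding number
  of that curve up to sign.\<close>

lemma cycle_cell_iff:
  assumes F: "F \<in> cells G" and fr: "frontier F = edges_drawing G (walk_edges k v)" and ch: "chain k x"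
  shows "cycle_cell G (marking x y) F \<longleftrightarrow> full k x"
proof
  assume "cycle_cell G (marking x y) F"
  then have "\<forall>e\<in>walk_edges k v. marked (marking x y) e"
    using boundary_edges_eq[OF fr] by (simp add: cycle_cell_def)
  then show "full k x"
    unfolding full_def using marked_marking unfolding walk_edges_def by blast
next
  assume f: "full k x"
  let ?J = "edges_drawing G (walk_edges k v)"
  obtain s where s: "\<forall>i<k. x i = Some s" using chain_full_const[OF ch f] by blast
  obtain g where g: "simple_path g" "pathfinish g = pathstart g" "path_image g = ?J"
    and wg: "\<And>z. z \<notin> ?J \<Longrightarrow> winding_number g z = (\<Sum>i<k. winding_number (side i) z)"
    using boundary_loop by blast
  note Jordan = Jordan_inside_outside[OF g(1,2), unfolded g(3)]
  have Fin: "F = inside ?J" by (rule cell_eq_inside[OF F fr])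
  have set: "{(p, q). (p, q) \<in> marking x y \<and> {p, q} \<in> boundary_edges G F} = arrow v s ` {..<k}"
  proof -
    have "(p, q) \<in> marking x y \<and> {p, q} \<in> walk_edges k v \<longleftrightarrow> (\<exists>i<k. (p, q) = arrow v s i)" for p q
    proof
      assume a: "(p, q) \<in> marking x y \<and> {p, q} \<in> walk_edges k v"
      then obtain i where i: "i < k" "{p, q} = {v i, v (Suc i)}" unfolding walk_edges_def by blast
      obtain t where t: "(p, q) = arrow v t i" using edge_arrow[OF i(2)] by blast
      then have "x i = Some t" using arrow_in_marking[OF i(1)] a by metis
      then show "\<exists>i<k. (p, q) = arrow v s i" using s i(1) t by auto
    next
      assume "\<exists>i<k. (p, q) = arrow v s i"
      then obtain i where i: "i < k" "(p, q) = arrow v s i" by blast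
      then have "{p, q} = {v i, v (Suc i)}" by (metis arrow_edge fst_conv snd_conv)
      then show "(p, q) \<in> marking x y \<and> {p, q} \<in> walk_edges k v"
        using i s arrow_in_marking[OF i(1)] unfolding walk_edges_def by auto
    qed
    then show ?thesis unfolding boundary_edges_eq[OF fr] by auto
  qed
  have bw: "boundary_winding G (marking x y) F z = (if s then 1 else - 1) * winding_number g z" if z: "z \<notin> ?J" for z
  proof -
    have "inj_on (arrow v s) {..<k}" using arrow_inj[OF v] by (auto simp: inj_on_def)
    then have "boundary_winding G (marking x y) F z =
        (\<Sum>i<k. (\<lambda>(p, q). winding_number (curve G p q) z) (arrow v s i))"
      unfolding boundary_winding_def set by (simp add: sum.reindex)
    also have "\<dots> = (\<Sum>i<k. (if s then 1 else - 1) * winding_number (side i) z)"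
    proof (intro sum.cong refl)
      fix i assume "i \<in> {..<k}"
      then have i: "i < k" by simp
      then have "z \<notin> path_image (side i)" using z unfolding edges_drawing_walk by blast
      then have "winding_number (curve G (v (Suc i)) (v i)) z = - winding_number (side i) z"
        using side_curve[OF i] by (simp add: winding_number_reversepath arc_imp_path)
      then show "(\<lambda>(p, q). winding_number (curve G p q) z) (arrow v s i) =
          (if s then 1 else - 1) * winding_number (side i) z"
        by (simp add: arrow_def)
    qed
    also have "\<dots> = (if s then 1 else - 1) * winding_number g z"
      by (simp only: sum_distrib_left wg[OF z])
    finally show ?thesis .
  qed
  have out: "boundary_winding G (marking x y) F z = 0" if "z \<notin> closure F" for z
  proof -
    have "z \<notin> ?J" "z \<notin> F" using that fr closure_Un_frontier[of F] by auto
    then have "z \<in> outside ?J" using Jordan Fin by blast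
    then have "winding_number g z = 0"
      using winding_number_zero_in_outside[OF _ g(2)] g(1,3) by (simp add: simple_path_imp_path)
    then show ?thesis using bw \<open>z \<notin> ?J\<close> by simp
  qed
  have notJ: "z \<notin> ?J" if "z \<in> F" for z using that Fin Jordan by blast
  \<comment> \<open>The walk may run around \<open>F\<close> in either sense; a cycle cell may be
    clockwise or counterclockwise, so both outcomes are acceptable.\<close>
  have "(\<forall>z\<in>F. winding_number g z = 1) \<or> (\<forall>z\<in>F. winding_number g z = - 1)"
    using simple_closed_path_winding_number_inside[OF g(1)] unfolding g(3) Fin by metis
  then have "clockwise_around G (marking x y) F \<or> counterclockwise_around G (marking x y) F"
    unfolding clockwise_around_def counterclockwise_around_def
    using out bw notJ by (cases s) auto
  moreover have "\<forall>e\<in>boundary_edges G F. marked (marking x y) e"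
    unfolding boundary_edges_eq[OF fr] walk_edges_def using marked_marking s by auto
  ultimately show "cycle_cell G (marking x y) F" using F by (simp add: cycle_cell_def)
qed

end

section \<open>Translation into the word game\<close>

context two_cycles
begin

abbreviation extremal_free :: "('v \<times> 'v) set \<Rightarrow> bool" where
  "extremal_free M \<equiv> \<forall>u. \<not> sink G M u \<and> \<not> source G M u"

lemma insert_arrow:
  assumes "i < k" "x i = None"
  shows "insert (arrow v s i) (marking x y) = marking (x(i \<mapsto> s)) y"
  by (simp add: marking_def marks_upd[of i k x, OF assms])

text \<open>\<open>legal_move\<close> forbids only new sinks and sources. From a marking without
  any, this amounts to having none afterwards.\<close>

lemma legal_move_arrow:
  assumes "extremal_free (marking x y)" "i < k" "x i = None"
  shows "legal_move G (marking x y) (arrow v s i) \<longleftrightarrow> extremal_free (marking (x(i \<mapsto> s)) y)"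
  unfolding legal_move_def arrow_edge marked_marking[OF assms(2)] insert_arrow[of i x s y, OF assms(2,3)]
  using assms(1,3) side_edge[OF assms(2)] by (simp add: all_conj_distrib)

lemma legal_move_cases:
  assumes "legal_move G (marking x y) m"
  obtains i s where "i < k" "x i = None" "m = arrow v s i"
    | j s where "j < l" "y j = None" "m = arrow w s j"
proof -
  interpret s: two_cycles G l k w v by (rule swap)
  have m: "{fst m, snd m} \<in> edges G" "\<not> marked (marking x y) {fst m, snd m}"
    using assms by (simp_all add: legal_move_def)
  from m(1) consider i where "i < k" "{fst m, snd m} = {v i, v (Suc i)}"
    | j where "j < l" "{fst m, snd m} = {w j, w (Suc j)}"
    unfolding edges walk_edges_def by blast
  then show ?thesis
  proof cases
    case 1
    then obtain s where "m = arrow v s i" using edge_arrow by (metis prod.collapse)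
    then show ?thesis using that(1) 1 m(2) marked_marking[OF 1(1)] by simp
  next
    case 2
    then obtain s where "m = arrow w s j" using edge_arrow by (metis prod.collapse)
    then show ?thesis using that(2) 2 m(2) s.marked_marking[OF 2(1), of y x, unfolded swap_marking] by simp
  qed
qed

end

lemma step_admissible: "step n p q \<Longrightarrow> admissible n (fst q) (snd q)"
  by (induction rule: step.induct) (simp_all only: fst_conv snd_conv)

locale triangle_cycle = two_cycles G 3 n v w
  for G :: "'v board" and n :: nat and v w :: "nat \<Rightarrow> 'v" +
  fixes F\<^sub>3 F\<^sub>n :: "complex set"
  assumes cells: "F\<^sub>3 \<in> cells G" "F\<^sub>n \<in> cells G"
    and frontiers: "frontier F\<^sub>3 = edges_drawing G (walk_edges 3 v)"
      "frontier F\<^sub>n = edges_drawing G (walk_edges n w)"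
begin

lemma extremal_free_iff: "extremal_free (marking x y) \<longleftrightarrow> admissible n x y"
  unfolding no_extremal_iff admissible_def by simp

lemma extremal_free_iff': "extremal_free (two_cycles.marking n 3 w v y x) \<longleftrightarrow> admissible n x y"
  unfolding swap_marking by (rule extremal_free_iff)

text \<open>Carries the moves of Player 1 from the word game to the board;
  \<open>legal_move_imp_step\<close> carries the moves of Player 2 the other way.\<close>

lemma step_imp_legal_move:
  assumes "step n (x, y) q" "admissible n x y"
  shows "\<exists>m. legal_move G (marking x y) m \<and> insert m (marking x y) = marking (fst q) (snd q)"
proof -
  interpret s: two_cycles G n 3 w v by (rule swap)
  from assms(1) show ?thesis
  proof cases
    case (left i s)
    then show ?thesis
      using insert_arrow[of i x s y, OF left(2,3)] legal_move_arrow[of x y i s, OF _ left(2,3)] assms(2)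
      by (intro exI[of _ "arrow v s i"]) (simp add: extremal_free_iff)
  next
    case (right j s)
    then show ?thesis
      using s.insert_arrow[of j y s x, OF right(2,3)] s.legal_move_arrow[of y x j s, OF _ right(2,3)] assms(2)
      unfolding extremal_free_iff' unfolding swap_marking
      by (intro exI[of _ "arrow w s j"]) simp
  qed
qed

lemma legal_move_imp_step:
  assumes "legal_move G (marking x y) m" "admissible n x y"
  shows "\<exists>q. step n (x, y) q \<and> insert m (marking x y) = marking (fst q) (snd q)"
proof -
  interpret s: two_cycles G n 3 w v by (rule swap)
  from assms(1) show ?thesis
  proof (cases rule: legal_move_cases)
    case (1 i s)
    then have "admissible n (x(i \<mapsto> s)) y"
      using legal_move_arrow[of x y i s, OF _ 1(1,2)] assms by (simp add: extremal_free_iff)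
    then have "step n (x, y) (x(i \<mapsto> s), y)" using 1 by (intro step.left)
    then show ?thesis using insert_arrow[of i x s y, OF 1(1,2)] 1(3) by fastforce
  next
    case (2 j s)
    then have "admissible n x (y(j \<mapsto> s))"
      using s.legal_move_arrow[of y x j s, OF _ 2(1,2)] assms unfolding extremal_free_iff' unfolding swap_marking
      by simp
    then have "step n (x, y) (x, y(j \<mapsto> s))" using 2 by (intro step.right)
    then show ?thesis using s.insert_arrow[of j y s x, OF 2(1,2)] 2(3) unfolding swap_marking by fastforce
  qed
qed

text \<open>The two given cells are the only ones, so filling a word is the only way to create a
  cycle cell.\<close>

lemma cycle_cell_iff_won:
  assumes "admissible n x y"
  shows "(\<exists>F. cycle_cell G (marking x y) F) \<longleftrightarrow> won n (x, y)"
proof -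
  interpret s: two_cycles G n 3 w v by (rule swap)
  have ch: "chain 3 x" "chain n y" using assms by (simp_all add: admissible_def)
  have "cycle_cell G (marking x y) F \<Longrightarrow> F \<in> {F\<^sub>3, F\<^sub>n}" for F
    using cells_subset[OF cells(1) frontiers(1) cells(2) frontiers(2)] by (auto simp: cycle_cell_def)
  then have "(\<exists>F. cycle_cell G (marking x y) F) \<longleftrightarrow>
      cycle_cell G (marking x y) F\<^sub>3 \<or> cycle_cell G (marking x y) F\<^sub>n" by blast
  also have "\<dots> \<longleftrightarrow> full 3 x \<or> full n y"
    using cycle_cell_iff[OF cells(1) frontiers(1) ch(1)]
      s.cycle_cell_iff[OF cells(2) frontiers(2) ch(2), of x, unfolded swap_marking] by simp
  finally show ?thesis by simp
qed

lemma player1_wins: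
  assumes "n \<ge> 4"
  shows "\<exists>\<sigma>. winning_strategy G Player1 \<sigma>"
proof -
  obtain I p where p: "step n (Map.empty, Map.empty) p" "I p" and safe: "safe n I"
    using ex_safe_opening[OF assms] by metis
  \<comment> \<open>Admissibility is recorded because the translation between markings and positions
    relies on it.\<close>
  define J where "J M \<longleftrightarrow> (\<exists>x y. M = marking x y \<and> admissible n x y \<and> I (x, y))" for M
  have JI: "J (marking (fst q) (snd q))" if "step n r q" "I q" for r q
    using step_admissible[OF that(1)] that(2) unfolding J_def by (metis prod.collapse)
  have won_iff: "(\<exists>F. cycle_cell G (marking (fst q) (snd q)) F) \<longleftrightarrow> won n q" if "step n r q" for r q
    using cycle_cell_iff_won[OF step_admissible[OF that]] by simp
  have e: "marking Map.empty Map.empty = {}" "admissible n Map.empty Map.empty"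
    by (simp_all add: marking_def marks_def admissible_def chain_def)
  obtain m\<^sub>0 where m0: "legal_move G {} m\<^sub>0" "{m\<^sub>0} = marking (fst p) (snd p)"
    using step_imp_legal_move[OF p(1) e(2)] unfolding e(1) by blast
  show ?thesis
  proof (rule winning_strategyI[where J = J and m\<^sub>0 = m\<^sub>0])
    show "\<not> (\<exists>F. cycle_cell G {} F)"
    proof -
      have "\<not> full 3 Map.empty" "\<not> full n Map.empty"
        using assms by (auto simp: full_def intro!: exI[of _ 0])
      then show ?thesis using cycle_cell_iff_won[OF e(2)] unfolding e(1) by simp
    qed
    show "legal_move G {} m\<^sub>0" by (rule m0)
    show "J {m\<^sub>0}" unfolding m0 by (rule JI[OF p])
  next
    fix M m
    assume "J M" and nc: "\<not> (\<exists>F. cycle_cell G M F)" and lm: "legal_move G M m"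
    then obtain x y where M: "M = marking x y" "admissible n x y" "I (x, y)" unfolding J_def by blast
    obtain q where q: "step n (x, y) q" "insert m M = marking (fst q) (snd q)"
      using legal_move_imp_step[OF lm[unfolded M(1)] M(2)] M(1) by blast
    have nw: "\<not> won n (x, y)" using nc cycle_cell_iff_won[OF M(2)] M(1) by simp
    obtain r where "\<not> won n q" and r: "step n q r" "won n r \<or> I r"
      using safe[unfolded safe_def, rule_format, OF M(3) nw q(1)] by blast
    obtain m' where m': "legal_move G (insert m M) m'" "insert m' (insert m M) = marking (fst r) (snd r)"
      using step_imp_legal_move[of "fst q" "snd q" r] step_admissible[OF q(1)] r(1) q(2) by auto
    have "\<not> (\<exists>F. cycle_cell G (insert m M) F)"
      using won_iff[OF q(1)] \<open>\<not> won n q\<close> unfolding q(2) by blast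
    moreover have "(\<exists>F. cycle_cell G (insert m' (insert m M)) F) \<or> J (insert m' (insert m M))"
      using won_iff[OF r(1)] JI[OF r(1)] r(2) unfolding m'(2) by blast
    ultimately show "\<not> (\<exists>F. cycle_cell G (insert m M) F) \<and>
      (\<exists>m'. legal_move G (insert m M) m' \<and>
        ((\<exists>F. cycle_cell G (insert m' (insert m M)) F) \<or> J (insert m' (insert m M))))"
      using m'(1) by blast
  qed
qed

end

theorem theorem5p1:
  fixes G :: "'v board" and n :: nat and a :: 'v
    and V\<^sub>3 V\<^sub>n :: "'v set" and E\<^sub>3 E\<^sub>n :: "'v set set" and F\<^sub>3 F\<^sub>n :: "complex set"
  assumes "n \<ge> 4"
    and "plane_board G"
    and "cycle_graph 3 V\<^sub>3 E\<^sub>3" and "cycle_graph n V\<^sub>n E\<^sub>n"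
    and "verts G = V\<^sub>3 \<union> V\<^sub>n" and "V\<^sub>3 \<inter> V\<^sub>n = {a}"
    and "edges G = E\<^sub>3 \<union> E\<^sub>n" and "E\<^sub>3 \<inter> E\<^sub>n = {}"
    and "F\<^sub>3 \<in> cells G" and "F\<^sub>n \<in> cells G" and "F\<^sub>3 \<noteq> F\<^sub>n"
    and "frontier F\<^sub>3 = edges_drawing G E\<^sub>3" and "frontier F\<^sub>n = edges_drawing G E\<^sub>n"
  shows "\<exists>\<sigma>. winning_strategy G Player1 \<sigma>"
proof -
  have a: "a \<in> V\<^sub>3" "a \<in> V\<^sub>n" using assms(6) by auto
  obtain v where v: "cycle_walk 3 v" "v 0 = a" "V\<^sub>3 = v ` {..<3}" "E\<^sub>3 = walk_edges 3 v"
    by (rule cycle_graph_walk[OF assms(3) a(1)])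
  obtain w where w: "cycle_walk n w" "w 0 = a" "V\<^sub>n = w ` {..<n}" "E\<^sub>n = walk_edges n w"
    by (rule cycle_graph_walk[OF assms(4) a(2)])
  interpret triangle_cycle G n v w F\<^sub>3 F\<^sub>n
    using assms(2,5-10,12,13) v(1,2) w(1,2) unfolding v(3,4) w(3,4)
    by unfold_locales simp_all
  show ?thesis by (rule player1_wins[OF assms(1)])
qed

end
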